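(* With $\Gamma$ graded by path length and quasi-hereditary with respect to $\le$, $\Gamma$ is standard Koszul: $\operatorname{Ext}^i_{\mathsf{gr}\Gamma}(\Delta,\Gamma_0\langle j\rangle)=0$ whenever $i\neq j$; equivalently, every standard module $\Delta_x$ (placed with its top in degree $0$) has a linear graded projective resolution.
   Context: Let $k$ be an algebraically closed field; modules are finitely generated right modules; for arrows $\alpha,\beta$ the product $\alpha\beta$ is the path traversing $\alpha$ first and then $\beta$; $e_x$ is the trivial path at $x$, $P_x=e_x\Gamma$, $S_x$ its simple top. For integers $n\ge1$, $m\ge1$, let $Q^{(n,m)}$ be the quiver whose vertices are the tuples $x=(x_0,\dots,x_n)\in\mathbb{Z}_{\ge0}^{n+1}$ with $\sum_i x_i=m-1$, with an arrow $\alpha_i:x\to x+f_i$ for each $i\in\{0,\dots,n\}$ and each vertex $x$ such that $x+f_i$ is a vertex; here for $1\le i\le n$ the vector $f_i\in\mathbb{Z}^{n+1}$ has entry $-1$ in position $i-1$, $+1$ in position $i$, $0$ elsewhere, and $f_0=(1,0,\dots,0,-1)$. The higher zigzag algebra $Z^n_m$ is $kQ^{(n,m)}$ modulo the relations: for every vertex $x$ and $i,j\in\{0,\dots,n\}$ such that $x+f_i$ and $x+f_i+f_j$ are vertices, the path $x\xrightarrow{\alpha_i}x+f_i\xrightarrow{\alpha_j}x+f_i+f_j$ is zero if $i=j$, and equals the path $x\xrightarrow{\alpha_j}x+f_j\xrightarrow{\alpha_i}x+f_i+f_j$ if $i\neq j$ and $x+f_j$ is a vertex. Fix $n\ge1$,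 $s\ge1$, put $Z^+=Z^n_{s+1}$, let $I$ be the vertex set of $Q^{(n,s+1)}$, $K=\{x\in I:x_0=0\}$, and $\Gamma=Z^+/(e_z\alpha_0\alpha_1 : z\in K)$, i.e. $Z^+$ modulo the additional relations that every path starting at a vertex of $K$ consisting of an arrow $\alpha_0$ followed by an arrow $\alpha_1$ is zero. Partially order $I$ by $x\le y$ iff there is a path from $x$ to $y$ in $Q^{(n,s+1)}$ using no arrow $\alpha_0$; the standard module $\Delta_x$ is the largest quotient of $P_x$ with no composition factor $S_y$, $y>x$, and $\Delta=\bigoplus_x\Delta_x$; $\Gamma$ is quasi-hereditary for this order. $\Gamma$ is graded by path length, $\Gamma_0=\bigoplus_x ke_x$; $\mathsf{gr}\Gamma$ denotes finitely generated graded modules with degree-zero morphisms, $(M\langle j\rangle)_i=M_{i-j}$. A graded module $M$ is linear if it has a graded projective resolution $\cdots\to P^1\to P^0\to M\to0$ with each $P^i$ generated in degree $i$. *)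

theory Defs
  imports Main "HOL-Computational_Algebra.Polynomial"
begin

definition vert :: "nat \<Rightarrow> nat \<Rightarrow> int list \<Rightarrow> bool" where
  "vert n m x \<longleftrightarrow> length x = Suc n \<and> list_all (\<lambda>a. 0 \<le> a) x \<and> sum_list x = int m - 1"

definition fvec :: "nat \<Rightarrow> nat \<Rightarrow> int list" where
  "fvec n i = map (\<lambda>j. (if j = i then 1 else 0) - (if j = (if i = 0 then n else i - 1) then 1 else 0)) [0..<Suc n]"

definition vadd :: "int list \<Rightarrow> int list \<Rightarrow> int list" where
  "vadd x y = map2 (+) x y"

text \<open>A path is a start vertex together with the list of arrow labels i (arrow alpha_i),
  traversed left to right.\<close>

type_synonym path = "int list \<times> nat list"

fun walk :: "nat \<Rightarrow> int list \<Rightarrow> nat list \<Rightarrow> int list" where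
  "walk n x [] = x"
| "walk n x (i # is) = walk n (vadd x (fvec n i)) is"

fun valid_walk :: "nat \<Rightarrow> nat \<Rightarrow> int list \<Rightarrow> nat list \<Rightarrow> bool" where
  "valid_walk n m x [] = vert n m x"
| "valid_walk n m x (i # is) = (vert n m x \<and> i \<le> n \<and> valid_walk n m (vadd x (fvec n i)) is)"

definition valid_path :: "nat \<Rightarrow> nat \<Rightarrow> path \<Rightarrow> bool" where
  "valid_path n m p \<longleftrightarrow> valid_walk n m (fst p) (snd p)"

definition ptgt :: "nat \<Rightarrow> path \<Rightarrow> int list" where
  "ptgt n p = walk n (fst p) (snd p)"

type_synonym 'k alg = "path \<Rightarrow> 'k"

definition inkQ :: "nat \<Rightarrow> nat \<Rightarrow> 'k::field alg \<Rightarrow> bool" where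
  "inkQ n m a \<longleftrightarrow> finite {p. a p \<noteq> 0} \<and> (\<forall>p. a p \<noteq> 0 \<longrightarrow> valid_path n m p)"

definition amult :: "nat \<Rightarrow> 'k::field alg \<Rightarrow> 'k alg \<Rightarrow> 'k alg" where
  "amult n a b = (\<lambda>(x, ws). \<Sum>j\<in>{0..length ws}. a (x, take j ws) * b (walk n x (take j ws), drop j ws))"

definition delta :: "path \<Rightarrow> 'k::field alg" where
  "delta p = (\<lambda>q. if q = p then 1 else 0)"

definition src_is :: "int list \<Rightarrow> 'k::field alg \<Rightarrow> bool" where
  "src_is x a \<longleftrightarrow> (\<forall>p. a p \<noteq> 0 \<longrightarrow> fst p = x)"

definition tgt_is :: "nat \<Rightarrow> int list \<Rightarrow> 'k::field alg \<Rightarrow> bool" where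
  "tgt_is n y a \<longleftrightarrow> (\<forall>p. a p \<noteq> 0 \<longrightarrow> ptgt n p = y)"

definition homog :: "nat \<Rightarrow> 'k::field alg \<Rightarrow> bool" where
  "homog d a \<longleftrightarrow> (\<forall>p. a p \<noteq> 0 \<longrightarrow> length (snd p) = d)"

inductive_set gen_ideal :: "nat \<Rightarrow> nat \<Rightarrow> 'k::field alg set \<Rightarrow> 'k alg set"
  for n m :: nat and R :: "'k alg set" where
  zero: "(\<lambda>_. 0) \<in> gen_ideal n m R"
| gen: "r \<in> R \<Longrightarrow> r \<in> gen_ideal n m R"
| add: "a \<in> gen_ideal n m R \<Longrightarrow> b \<in> gen_ideal n m R \<Longrightarrow> (\<lambda>p. a p + b p) \<in> gen_ideal n m R"
| smult: "a \<in> gen_ideal n m R \<Longrightarrow> (\<lambda>p. c * a p) \<in> gen_ideal n m R"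
| lmult: "a \<in> gen_ideal n m R \<Longrightarrow> valid_path n m q \<Longrightarrow> amult n (delta q) a \<in> gen_ideal n m R"
| rmult: "a \<in> gen_ideal n m R \<Longrightarrow> valid_path n m q \<Longrightarrow> amult n a (delta q) \<in> gen_ideal n m R"

definition zz_rels :: "nat \<Rightarrow> nat \<Rightarrow> 'k::field alg set" where
  "zz_rels n m =
     {delta (x, [i, i]) | x i. valid_walk n m x [i, i]}
   \<union> {(\<lambda>p. delta (x, [i, j]) p - delta (x, [j, i]) p) | x i j.
        i \<noteq> j \<and> valid_walk n m x [i, j] \<and> valid_walk n m x [j]}"

definition Gamma_ideal :: "nat \<Rightarrow> nat \<Rightarrow> 'k::field alg set" where
  "Gamma_ideal n s = gen_ideal n (Suc s)
     (zz_rels n (Suc s) \<union> {delta (z, [0, 1]) | z. valid_walk n (Suc s) z [0, 1] \<and> z ! 0 = 0})"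

definition vle :: "nat \<Rightarrow> nat \<Rightarrow> int list \<Rightarrow> int list \<Rightarrow> bool" where
  "vle n m x y \<longleftrightarrow> (\<exists>ws. valid_walk n m x ws \<and> 0 \<notin> set ws \<and> walk n x ws = y)"

definition right_submod :: "nat \<Rightarrow> nat \<Rightarrow> 'k::field alg set \<Rightarrow> bool" where
  "right_submod n m U \<longleftrightarrow> (\<lambda>_. 0) \<in> U
     \<and> (\<forall>a\<in>U. \<forall>b\<in>U. (\<lambda>p. a p + b p) \<in> U)
     \<and> (\<forall>a\<in>U. \<forall>c. (\<lambda>p. c * a p) \<in> U)
     \<and> (\<forall>a\<in>U. \<forall>q. valid_path n m q \<longrightarrow> amult n a (delta q) \<in> U)"

text \<open>Delta_x = P_x / U where U is the preimage in e_x kQ of the smallest submodule of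
  P_x = e_x Gamma such that the quotient has no composition factor S_y (i.e. vanishing
  e_y-part) for all y > x.\<close>
definition std_kernel :: "nat \<Rightarrow> nat \<Rightarrow> 'k::field alg set \<Rightarrow> int list \<Rightarrow> 'k alg set" where
  "std_kernel n m I x = \<Inter> {U. (\<forall>a\<in>U. inkQ n m a \<and> src_is x a) \<and> right_submod n m U
       \<and> (\<forall>a\<in>I. src_is x a \<longrightarrow> a \<in> U)
       \<and> (\<forall>y a. vle n m x y \<and> y \<noteq> x \<and> inkQ n m a \<and> src_is x a \<and> tgt_is n y a \<longrightarrow> a \<in> U)}"

text \<open>Elements of the free module P(L) = direct sum over b of P_{L!b}, lifted to kQ.\<close>
definition in_free :: "nat \<Rightarrow> nat \<Rightarrow> int list list \<Rightarrow> (nat \<Rightarrow> 'k::field alg) \<Rightarrow> bool" where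
  "in_free n m L v \<longleftrightarrow> (\<forall>b<length L. inkQ n m (v b) \<and> src_is (L ! b) (v b))
     \<and> (\<forall>b\<ge>length L. v b = (\<lambda>_. 0))"

text \<open>Matrix D (entries D a b in e_{L0!a} kQ e_{L1!b}) acting by left multiplication,
  P(L1) \<rightarrow> P(L0).\<close>
definition matapp :: "nat \<Rightarrow> (nat \<Rightarrow> nat \<Rightarrow> 'k::field alg) \<Rightarrow> nat \<Rightarrow> nat \<Rightarrow> (nat \<Rightarrow> 'k alg) \<Rightarrow> (nat \<Rightarrow> 'k alg)" where
  "matapp n D l0 l1 v = (\<lambda>a p. if a < l0 then (\<Sum>b<l1. amult n (D a b) (v b) p) else 0)"

text \<open>A degree-zero graded map P(L1)<i+1> \<rightarrow> P(L0)<i>: entries are linear combinations of arrows.\<close>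
definition lin_map :: "nat \<Rightarrow> nat \<Rightarrow> int list list \<Rightarrow> int list list \<Rightarrow> (nat \<Rightarrow> nat \<Rightarrow> 'k::field alg) \<Rightarrow> bool" where
  "lin_map n m L0 L1 D \<longleftrightarrow> (\<forall>a<length L0. \<forall>b<length L1.
     inkQ n m (D a b) \<and> src_is (L0 ! a) (D a b) \<and> tgt_is n (L1 ! b) (D a b) \<and> homog 1 (D a b))"

text \<open>Delta_x (top in degree 0) has a linear graded projective resolution
  ... \<rightarrow> P^1 \<rightarrow> P^0 \<rightarrow> Delta_x \<rightarrow> 0, P^i = direct sum of P_y<i> for y in L i,
  differentials D (Suc i) : P^(i+1) \<rightarrow> P^i, augmentation eps of degree 0.
  All congruences are modulo the ideal I (i.e. computed in Gamma = kQ/I), and modulo U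
  in Delta_x.\<close>
definition has_linear_resolution :: "nat \<Rightarrow> nat \<Rightarrow> 'k::field alg set \<Rightarrow> int list \<Rightarrow> bool" where
  "has_linear_resolution n m I x \<longleftrightarrow>
    (let U = std_kernel n m I x in
     \<exists>(L :: nat \<Rightarrow> int list list) (D :: nat \<Rightarrow> nat \<Rightarrow> nat \<Rightarrow> 'k alg) (eps :: nat \<Rightarrow> 'k alg).
       (\<forall>i. \<forall>a<length (L i). vert n m (L i ! a))
     \<and> (\<forall>i. lin_map n m (L i) (L (Suc i)) (D (Suc i)))
     \<and> (\<forall>b<length (L 0). inkQ n m (eps b) \<and> src_is x (eps b) \<and> tgt_is n (L 0 ! b) (eps b)
          \<and> homog 0 (eps b))
     \<and> (let aug = (\<lambda>v p. \<Sum>b<length (L 0). amult n (eps b) (v b) p);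
            d = (\<lambda>i. matapp n (D i) (length (L (i - 1))) (length (L i)))
        in
          (\<forall>w. inkQ n m w \<and> src_is x w \<longrightarrow>
              (\<exists>v. in_free n m (L 0) v \<and> (\<lambda>p. aug v p - w p) \<in> U))
        \<and> (\<forall>u. in_free n m (L 1) u \<longrightarrow> aug (d 1 u) \<in> U)
        \<and> (\<forall>v. in_free n m (L 0) v \<and> aug v \<in> U \<longrightarrow>
              (\<exists>u. in_free n m (L 1) u \<and> (\<forall>b<length (L 0). (\<lambda>p. v b p - d 1 u b p) \<in> I)))
        \<and> (\<forall>i u. in_free n m (L (Suc (Suc i))) u \<longrightarrow>
              (\<forall>a<length (L i). d (Suc i) (d (Suc (Suc i)) u) a \<in> I))
        \<and> (\<forall>i v. in_free n m (L (Suc i)) v \<and> (\<forall>a<length (L i). d (Suc i) v a \<in> I) \<longrightarrow>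
              (\<exists>u. in_free n m (L (Suc (Suc i))) u \<and>
                   (\<forall>b<length (L (Suc i)). (\<lambda>p. v b p - d (Suc (Suc i)) u b p) \<in> I)))))"

end

(* Sorting the labels of a path in the order 1 < 2 < ... < n < 0 shows that e_x Gamma has a basis
   indexed by label sets A: each label is used at most once, label i + 1 (read modulo n + 1) needs
   x_i > 0 or i in A for i > 0, and label 1 needs x_0 > 0.  The standard module at x
   keeps only the label sets {} and {0}.  Since the arrows commute and square to zero, its resolution has the shape of a tensor
   product of n resolutions of k over k[t]/(t^2): in degree i it is the sum of the projectives at
   x + d_1 f_1 + ... + d_n f_n over d with |d| = i and d_j <= x_(j-1), with differential
   (d, A) -> sum over j not in A of +-(d - e_j, A + {j}).  The multidegree t with
   t_j = d_j + [j in A] is preserved, and every piece with t nonzero is contracted along the least j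
   with t_j > 0. *)
theory Submission
  imports Defs
begin

text \<open>The relations dictate the order of the labels. Exchanging consecutive arrows i, j at x
  can fail only if alpha_i supplies the unit that alpha_j consumes, that is, if i =
  \<open>prd j\<close> and x has entry 0 there. With the cyclic order cut before 1, the wrap-around
  pair alpha_0 alpha_1 is the only one that sorting has to exchange and may be unable to, and it is
  exactly the path that the extra relation kills where x_0 = 0. Independence of the sorted paths
  comes from the functionals \<open>coef\<close>, which vanish on the ideal; they turn exactness
  into linear algebra on coordinates (d, A). The bound d_j <= x_(j-1) truncates the tensor product,
  so a contraction along an arbitrary j could leave the box. For the least j it cannot: if j is in
  A, a sorted path with label set A begins with alpha_j, and since d_(j-1) = 0, the unit consumed by
  this arrow shows d_j < x_(j-1).\<close>

text \<open>The order \<open>1 < 2 < \<dots> < n < 0\<close> on arrow labels.\<close>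

definition lt :: "nat \<Rightarrow> nat \<Rightarrow> bool" where
  "lt i j \<longleftrightarrow> i \<noteq> 0 \<and> (j = 0 \<or> i < j)"

lemma lt_linear: "lt i j \<or> i = j \<or> lt j i"
  by (auto simp: lt_def)

lemma lt_trans: "lt i j \<Longrightarrow> lt j k \<Longrightarrow> lt i k"
  by (auto simp: lt_def)

lemma lt_sorted_unique:
  assumes "sorted_wrt lt v" "sorted_wrt lt w" "set v = set w"
  shows "v = w"
  using assms
proof (induction v arbitrary: w)
  case Nil
  then show ?case by simp
next
  case (Cons i v)
  then obtain j w' where w: "w = j # w'" by (cases w) auto
  have "\<not> lt i j \<or> \<not> lt j i" by (auto simp: lt_def)
  moreover have "i \<in> insert j (set w')" "j \<in> insert i (set v)"
    using Cons.prems(3) unfolding w by auto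
  ultimately have eq: "i = j"
    using Cons.prems(1,2) unfolding w by auto
  have "i \<notin> set v" "i \<notin> set w'"
    using Cons.prems unfolding w eq by (auto simp: lt_def)
  then have "set v = set w'" using Cons.prems(3) unfolding w eq by auto
  then show ?case using Cons unfolding w eq by auto
qed

lemma lt_sorted_distinct: "sorted_wrt lt w \<Longrightarrow> distinct w"
  by (induction w) (auto simp: lt_def)

section \<open>Walks and paths\<close>

locale zigzag =
  fixes n s :: nat
  assumes n_pos: "1 \<le> n"
begin

abbreviation "m \<equiv> Suc s"

text \<open>The position where f_i has entry -1: alpha_i moves one unit from coordinate
  \<open>prd i\<close> to coordinate i.\<close>

definition prd :: "nat \<Rightarrow> nat" where
  "prd i = (if i = 0 then n else i - 1)"

abbreviation step :: "int list \<Rightarrow> nat \<Rightarrow> int list" where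
  "step x i \<equiv> vadd x (fvec n i)"

lemma prd_le: "i \<le> n \<Longrightarrow> prd i \<le> n"
  and prd_neq: "prd i \<noteq> i"
  and prd_eq_0_iff: "prd i = 0 \<longleftrightarrow> i = 1"
  using n_pos by (auto simp: prd_def)

lemma length_fvec [simp]: "length (fvec n i) = Suc n"
  by (simp add: fvec_def)

lemma length_vadd [simp]: "length (vadd x y) = min (length x) (length y)"
  by (simp add: vadd_def)

lemma nth_fvec:
  "k \<le> n \<Longrightarrow> fvec n i ! k = (if k = i then 1 else 0) - (if k = prd i then 1 else 0)"
  unfolding fvec_def prd_def by (subst nth_map) (auto simp del: upt_Suc)

lemma nth_step: "length x = Suc n \<Longrightarrow> k \<le> n \<Longrightarrow>
  step x i ! k = x ! k + (if k = i then 1 else 0) - (if k = prd i then 1 else 0)"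
  by (simp add: vadd_def nth_fvec)

lemma vert_iff: "vert n m x \<longleftrightarrow>
  length x = Suc n \<and> (\<forall>k\<le>n. 0 \<le> x ! k) \<and> (\<Sum>k\<le>n. x ! k) = int s"
  by (auto simp: vert_def list_all_length sum_list_sum_nth atLeast0LessThan lessThan_Suc_atMost
      less_Suc_eq_le)

lemma vert_length: "vert n m x \<Longrightarrow> length x = Suc n"
  by (simp add: vert_def)

text \<open>A step keeps the sum of the entries, and \<open>prd i\<close> is the only coordinate
  that it lowers.\<close>

lemma vert_step_iff:
  assumes "vert n m x" "i \<le> n"
  shows "vert n m (step x i) \<longleftrightarrow> 0 < x ! prd i"
proof -
  have l: "length x = Suc n" and nn: "\<And>k. k \<le> n \<Longrightarrow> 0 \<le> x ! k"
    using assms by (auto simp: vert_iff)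
  have "(\<Sum>k\<le>n. step x i ! k) =
    (\<Sum>k\<le>n. x ! k + (if k = i then 1 else 0) - (if k = prd i then 1 else 0))"
    by (rule sum.cong) (auto simp: nth_step l)
  also have "\<dots> = (\<Sum>k\<le>n. x ! k)"
    using assms prd_le[of i] by (simp add: sum.distrib sum_subtractf)
  finally have "(\<Sum>k\<le>n. step x i ! k) = (\<Sum>k\<le>n. x ! k)" .
  moreover have "(\<forall>k\<le>n. 0 \<le> step x i ! k) \<longleftrightarrow> 0 < x ! prd i"
  proof
    assume "\<forall>k\<le>n. 0 \<le> step x i ! k"
    then have "0 \<le> step x i ! prd i" using prd_le assms by auto
    then show "0 < x ! prd i" using prd_neq[of i] prd_le assms by (simp add: nth_step l)
  next
    assume "0 < x ! prd i"
    then show "\<forall>k\<le>n. 0 \<le> step x i ! k" using nn by (auto simp: nth_step l)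
  qed
  ultimately show ?thesis using assms l by (simp add: vert_iff)
qed

lemma length_walk: "length x = Suc n \<Longrightarrow> length (walk n x w) = Suc n"
  by (induction w arbitrary: x) auto

lemma valid_walk_vert: "valid_walk n m x w \<Longrightarrow> vert n m x"
  by (cases w) auto

lemma valid_walk_append:
  "valid_walk n m x (u @ v) \<longleftrightarrow> valid_walk n m x u \<and> valid_walk n m (walk n x u) v"
  by (induction u arbitrary: x) (auto dest: valid_walk_vert)

lemma valid_walk_labels: "valid_walk n m x w \<Longrightarrow> set w \<subseteq> {..n}"
  by (induction w arbitrary: x) auto

lemma nth_walk: "length x = Suc n \<Longrightarrow> k \<le> n \<Longrightarrow>
  walk n x w ! k = x ! k + (\<Sum>i\<leftarrow>w. (if k = i then 1 else 0) - (if k = prd i then 1 else 0))"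
  by (induction w arbitrary: x) (auto simp: nth_step)

text \<open>The endpoint is x plus the sum of the vectors f_i of the labels, so reordering the
  labels does not change it.\<close>

lemma walk_cong_set:
  assumes "length x = Suc n" "distinct v" "distinct w" "set v = set w"
  shows "walk n x v = walk n x w"
proof (rule nth_equalityI)
  show "length (walk n x v) = length (walk n x w)" using assms(1) by (simp add: length_walk)
  fix k assume "k < length (walk n x v)"
  then have "k \<le> n" using assms(1) by (simp add: length_walk)
  then show "walk n x v ! k = walk n x w ! k"
    using assms by (simp add: nth_walk sum_list_distinct_conv_sum_set)
qed

text \<open>Only alpha_1 takes from coordinate 0.\<close>

lemma walk_nth_0_mono:
  "length x = Suc n \<Longrightarrow> 1 \<notin> set w \<Longrightarrow> x ! 0 \<le> walk n x w ! 0"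
proof (induction w arbitrary: x)
  case (Cons i w)
  have "x ! 0 \<le> step x i ! 0" using Cons.prems prd_eq_0_iff[of i] by (auto simp: nth_step)
  also have "\<dots> \<le> walk n (step x i) w ! 0" using Cons by auto
  finally show ?case by simp
qed auto

section \<open>Products with a single path, and closure properties of kQ\<close>

lemma amult_delta_left:
  "amult n (delta (y, u)) a (x, w) =
    (if x = y \<and> take (length u) w = u then a (walk n y u, drop (length u) w) else 0)"
proof -
  have "amult n (delta (y, u)) a (x, w) =
    (\<Sum>j\<in>{0..length w}. if j = length u \<and> x = y \<and> take (length u) w = u
       then a (walk n y u, drop (length u) w) else 0)"
    unfolding amult_def delta_def prod.case
    by (rule sum.cong) auto
  also have "\<dots> = (if x = y \<and> take (length u) w = u then a (walk n y u, drop (length u) w) else 0)"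
    by (cases "length u \<le> length w") (auto simp: sum.delta' sum.delta)
  finally show ?thesis .
qed

lemma amult_delta_right:
  "amult n a (delta (z, u)) (x, w) =
    (if length u \<le> length w \<and> drop (length w - length u) w = u
        \<and> walk n x (take (length w - length u) w) = z
     then a (x, take (length w - length u) w) else 0)"
proof -
  have "amult n a (delta (z, u)) (x, w) =
    (\<Sum>j\<in>{0..length w}. if j = length w - length u \<and> length u \<le> length w
        \<and> drop (length w - length u) w = u \<and> walk n x (take (length w - length u) w) = z
       then a (x, take (length w - length u) w) else 0)"
    unfolding amult_def delta_def prod.case
    by (rule sum.cong) auto
  also have "\<dots> = (if length u \<le> length w \<and> drop (length w - length u) w = u
        \<and> walk n x (take (length w - length u) w) = z
     then a (x, take (length w - length u) w) else 0)"
    by (auto simp: sum.delta' sum.delta)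
  finally show ?thesis .
qed

lemma amult_delta_delta:
  "amult n (delta (x, u)) (delta (walk n x u, v)) = (delta (x, u @ v) :: 'k::field alg)"
proof
  fix p :: path
  obtain y w where p: "p = (y, w)" by fastforce
  have "take (length u) w = u \<and> drop (length u) w = v \<longleftrightarrow> w = u @ v"
    by (metis append_eq_conv_conj append_take_drop_id)
  then show "amult n (delta (x, u)) (delta (walk n x u, v)) p = (delta (x, u @ v) p :: 'k::field)"
    unfolding p amult_delta_left by (auto simp: delta_def)
qed

lemma amult_diff_right: "amult n a (\<lambda>p. b p - c p) = (\<lambda>p. amult n a b p - amult n a c p)"
  by (auto simp: amult_def fun_eq_iff algebra_simps sum_subtractf)

lemma amult_diff_left: "amult n (\<lambda>p. a p - b p) c = (\<lambda>p. amult n a c p - amult n b c p)"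
  by (auto simp: amult_def fun_eq_iff algebra_simps sum_subtractf)

lemma inkQ_zero: "inkQ n m (\<lambda>p. 0)"
  by (simp add: inkQ_def)

lemma inkQ_add: "inkQ n m a \<Longrightarrow> inkQ n m b \<Longrightarrow> inkQ n m (\<lambda>p. a p + b p)"
  unfolding inkQ_def
  by (auto intro: finite_subset[of _ "{p. a p \<noteq> 0} \<union> {p. b p \<noteq> 0}"]) (metis add.right_neutral)

lemma inkQ_smult: "inkQ n m a \<Longrightarrow> inkQ n m (\<lambda>p. c * a p)"
  unfolding inkQ_def by (auto intro: finite_subset[of _ "{p. a p \<noteq> 0}"])

lemma inkQ_diff: "inkQ n m a \<Longrightarrow> inkQ n m b \<Longrightarrow> inkQ n m (\<lambda>p. a p - b p)"
  using inkQ_add[of a "\<lambda>p. (-1) * b p"] inkQ_smult[of b "-1"] by simp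

lemma inkQ_sum: "finite S \<Longrightarrow> (\<And>i. i \<in> S \<Longrightarrow> inkQ n m (f i)) \<Longrightarrow> inkQ n m (\<lambda>p. \<Sum>i\<in>S. f i p)"
  by (induction S rule: finite_induct) (auto simp: inkQ_zero inkQ_add)

lemma inkQ_delta: "inkQ n m (delta p :: 'k::field alg) \<longleftrightarrow> valid_path n m p"
  by (cases p) (auto simp: inkQ_def delta_def)

lemma inkQ_amult_delta_left:
  assumes "valid_path n m q" "inkQ n m a"
  shows "inkQ n m (amult n (delta q) a)"
proof -
  obtain y u where q: "q = (y, u)" by fastforce
  have "p \<in> (\<lambda>(z, v). (y, u @ v)) ` {p. a p \<noteq> 0} \<and> valid_path n m p"
    if "amult n (delta q) a p \<noteq> 0" for p
  proof -
    obtain x w where p: "p = (x, w)" by fastforce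
    from that have *: "x = y" "take (length u) w = u" "a (walk n y u, drop (length u) w) \<noteq> 0"
      unfolding p q amult_delta_left by (auto split: if_splits)
    then have w: "w = u @ drop (length u) w" by (metis append_take_drop_id)
    have "valid_walk n m y (u @ drop (length u) w)"
      using * assms unfolding valid_walk_append inkQ_def q valid_path_def by auto
    then show ?thesis using * w unfolding p valid_path_def by force
  qed
  then show ?thesis using assms unfolding inkQ_def
    by (auto intro: finite_subset[of _ "(\<lambda>(z, v). (y, u @ v)) ` {p. a p \<noteq> 0}"])
qed

lemma inkQ_amult_delta_right:
  assumes "valid_path n m q" "inkQ n m a"
  shows "inkQ n m (amult n a (delta q))"
proof -
  obtain z u where q: "q = (z, u)" by fastforce
  have "p \<in> (\<lambda>(x, v). (x, v @ u)) ` {p. a p \<noteq> 0} \<and> valid_path n m p"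
    if "amult n a (delta q) p \<noteq> 0" for p
  proof -
    obtain x w where p: "p = (x, w)" by fastforce
    define v where "v = take (length w - length u) w"
    from that have *: "drop (length w - length u) w = u" "walk n x v = z" "a (x, v) \<noteq> 0"
      unfolding p q amult_delta_right v_def by (auto split: if_splits)
    then have w: "w = v @ u" unfolding v_def by (metis append_take_drop_id)
    have "valid_walk n m x (v @ u)"
      using * assms unfolding valid_walk_append inkQ_def q valid_path_def by auto
    then show ?thesis using * w unfolding p valid_path_def by force
  qed
  then show ?thesis using assms unfolding inkQ_def
    by (auto intro: finite_subset[of _ "(\<lambda>(x, v). (x, v @ u)) ` {p. a p \<noteq> 0}"])
qed

section \<open>A basis of Gamma\<close>

definition words :: "int list \<Rightarrow> nat set \<Rightarrow> nat list set" where
  "words x A = {w. distinct w \<and> set w = A \<and> valid_walk n m x w}"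

text \<open>In Gamma the labels of a nonzero path are distinct, and such a path is determined by its source
  and its label set, so these sums are the coordinates of \<open>a\<close> in Gamma. A label set containing 1 at
  a vertex with vanishing first entry forces the killed factor \<open>\<alpha>\<^sub>0\<alpha>\<^sub>1\<close>.\<close>

definition coef :: "'k::field alg \<Rightarrow> int list \<Rightarrow> nat set \<Rightarrow> 'k" where
  "coef a x A = (if 1 \<in> A \<and> x ! 0 = 0 then 0 else \<Sum>w\<in>words x A. a (x, w))"

lemma finite_words: "finite (words x A)"
proof (cases "finite A")
  case True
  have "words x A \<subseteq> {w. set w \<subseteq> A \<and> length w \<le> card A}"
    by (auto simp: words_def distinct_card[symmetric])
  then show ?thesis using finite_lists_length_le[OF True] finite_subset by blast
qed (auto simp: words_def intro: finite_subset[of _ "{}"])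

lemma coef_zero [simp]: "coef (\<lambda>p. 0) x A = 0"
  and coef_add: "coef (\<lambda>p. a p + b p) x A = coef a x A + coef b x A"
  and coef_diff: "coef (\<lambda>p. a p - b p) x A = coef a x A - coef b x A"
  and coef_smult: "coef (\<lambda>p. c * a p) x A = c * coef a x A"
  by (auto simp: coef_def sum.distrib sum_subtractf sum_distrib_left)

lemma coef_sum: "finite S \<Longrightarrow> coef (\<lambda>p. \<Sum>i\<in>S. f i p) x A = (\<Sum>i\<in>S. coef (f i) x A)"
  by (induction S rule: finite_induct) (auto simp: coef_add)

lemma coef_delta: "coef (delta (y, u)) x A =
  (if x = y \<and> u \<in> words x A \<and> \<not> (1 \<in> A \<and> x ! 0 = 0) then 1 else 0 :: 'k::field)"
proof -
  have "(\<Sum>w\<in>words x A. delta (y, u) (x, w) :: 'k) = (\<Sum>w\<in>words x A. if w = u then if x = y then 1 else 0 else 0)"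
    by (rule sum.cong) (auto simp: delta_def)
  then show ?thesis using finite_words[of x A] by (auto simp: coef_def sum.delta)
qed

text \<open>Cutting off u matches the words of A that begin with u to the words of A - set u at the
  endpoint of u. If u repeats a label or leaves A, no word of A begins with u.\<close>

lemma coef_amult_left:
  assumes "valid_walk n m x u"
  shows "coef (amult n (delta (x, u)) a) x A =
    (if distinct u \<and> set u \<subseteq> A \<and> \<not> (1 \<in> A \<and> x ! 0 = 0)
     then coef a (walk n x u) (A - set u) else 0)"
proof (cases "distinct u \<and> set u \<subseteq> A \<and> \<not> (1 \<in> A \<and> x ! 0 = 0)")
  case True
  let ?z = "walk n x u"
  have len: "length x = Suc n" using assms valid_walk_vert vert_length by blast
  \<comment> \<open>The default value 0 of \<open>coef\<close> does not apply at x, and so not at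
    the endpoint either: if u avoids label 1, coordinate 0 has not dropped along u.\<close>
  have good: "\<not> (1 \<in> A - set u \<and> ?z ! 0 = 0)"
  proof
    assume *: "1 \<in> A - set u \<and> ?z ! 0 = 0"
    then have "x ! 0 \<le> 0" using walk_nth_0_mono[OF len] by (metis DiffE)
    moreover have "0 \<le> x ! 0" using assms valid_walk_vert vert_iff by blast
    ultimately show False using True * by auto
  qed
  have img: "{w \<in> words x A. take (length u) w = u} = (\<lambda>v. u @ v) ` words ?z (A - set u)"
  proof (intro equalityI subsetI)
    fix w assume "w \<in> {w \<in> words x A. take (length u) w = u}"
    then have *: "w \<in> words x A" and w: "w = u @ drop (length u) w"
      by auto (metis append_take_drop_id)
    define v where "v = drop (length u) w"
    have w': "w = u @ v" using w by (simp add: v_def)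
    have "v \<in> words ?z (A - set u)"
      using * unfolding w' words_def by (auto simp: valid_walk_append)
    then show "w \<in> (\<lambda>v. u @ v) ` words ?z (A - set u)" using w' by auto
  next
    fix w assume "w \<in> (\<lambda>v. u @ v) ` words ?z (A - set u)"
    then show "w \<in> {w \<in> words x A. take (length u) w = u}"
      using True assms by (auto simp: words_def valid_walk_append)
  qed
  have "coef (amult n (delta (x, u)) a) x A =
    (\<Sum>w\<in>words x A. if take (length u) w = u then a (?z, drop (length u) w) else 0)"
    using True by (auto simp: coef_def amult_delta_left)
  also have "\<dots> = (\<Sum>w\<in>{w \<in> words x A. take (length u) w = u}. a (?z, drop (length u) w))"
    using finite_words by (simp add: sum.inter_filter)
  also have "\<dots> = (\<Sum>v\<in>words ?z (A - set u). a (?z, v))"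
    unfolding img by (subst sum.reindex) (auto simp: inj_on_def)
  also have "\<dots> = coef a ?z (A - set u)" using good by (auto simp: coef_def)
  finally show ?thesis using True by simp
next
  case False
  have "(if take (length u) w = u then a (walk n x u, drop (length u) w) else 0) = 0"
    if "w \<in> words x A" "\<not> (1 \<in> A \<and> x ! 0 = 0)" for w
  proof -
    have "take (length u) w \<noteq> u"
      using that False unfolding words_def mem_Collect_eq
      by (metis distinct_take set_take_subset)
    then show ?thesis by simp
  qed
  then have "coef (amult n (delta (x, u)) a) x A = 0"
    by (simp add: coef_def amult_delta_left)
  then show ?thesis using False by auto
qed

lemma coef_amult_left_other: "x \<noteq> y \<Longrightarrow> coef (amult n (delta (y, u)) a) x A = 0"
  by (simp add: coef_def amult_delta_left)

text \<open>All words with a given label set end at the same vertex, so the condition that the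
  remaining prefix ends at z holds for all of them or for none: the sum is a whole coordinate of a
  or empty. Only subsets of A enter, so the lemma serves both the ideal and, later, the submodule
  cut out by \<open>A \<subseteq> {0}\<close>.\<close>

lemma coef_amult_right_zero:
  assumes q: "valid_path n m q" and a: "\<And>B. B \<subseteq> A \<Longrightarrow> coef a x B = 0"
  shows "coef (amult n a (delta q)) x A = 0"
proof -
  obtain z u where q': "q = (z, u)" by fastforce
  have vu: "valid_walk n m z u" using q by (simp add: q' valid_path_def)
  let ?P = "\<lambda>w. length u \<le> length w \<and> drop (length w - length u) w = u
        \<and> walk n x (take (length w - length u) w) = z"
  let ?V = "{v \<in> words x (A - set u). walk n x v = z}"
  show ?thesis
  proof (cases "distinct u \<and> set u \<subseteq> A \<and> \<not> (1 \<in> A \<and> x ! 0 = 0)")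
    case True
    have img: "{w \<in> words x A. ?P w} = (\<lambda>v. v @ u) ` ?V"
    proof (intro equalityI subsetI)
      fix w assume *: "w \<in> {w \<in> words x A. ?P w}"
      define v where "v = take (length w - length u) w"
      have w': "w = v @ u" using * unfolding v_def by simp (metis append_take_drop_id)
      have "v \<in> ?V"
        using * unfolding w' words_def by (auto simp: valid_walk_append)
      then show "w \<in> (\<lambda>v. v @ u) ` ?V" using w' by auto
    next
      fix w assume "w \<in> (\<lambda>v. v @ u) ` ?V"
      then show "w \<in> {w \<in> words x A. ?P w}"
        using True vu by (auto simp: words_def valid_walk_append)
    qed
    have "coef (amult n a (delta q)) x A =
      (\<Sum>w\<in>words x A. if ?P w then a (x, take (length w - length u) w) else 0)"
      using True by (auto simp: coef_def amult_delta_right q')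
    also have "\<dots> = (\<Sum>w\<in>{w \<in> words x A. ?P w}. a (x, take (length w - length u) w))"
      using finite_words by (simp add: sum.inter_filter)
    also have "\<dots> = (\<Sum>v\<in>?V. a (x, v))"
      unfolding img by (subst sum.reindex) (auto simp: inj_on_def)
    also have "\<dots> = 0"
    proof (cases "?V = {}")
      case False
      then obtain v0 where v0: "v0 \<in> ?V" by blast
      then have "length x = Suc n" using valid_walk_vert vert_length unfolding words_def by blast
      then have "?V = words x (A - set u)"
        using v0 walk_cong_set[of x _ v0] by (auto simp: words_def)
      then show ?thesis using a[of "A - set u", OF Diff_subset] True by (auto simp: coef_def split: if_splits)
    qed (simp only: sum.empty)
    finally show ?thesis .
  next
    case False
    have "(if ?P w then a (x, take (length w - length u) w) else 0) = 0"
      if "w \<in> words x A" "\<not> (1 \<in> A \<and> x ! 0 = 0)" for w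
    proof -
      have "\<not> ?P w" using that False unfolding words_def mem_Collect_eq
        by (metis distinct_drop set_drop_subset)
      then show ?thesis by (simp only: if_False)
    qed
    then show ?thesis by (auto simp: coef_def amult_delta_right q' intro!: sum.neutral)
  qed
qed

section \<open>The ideal lies in the common kernel of the coordinates\<close>

abbreviation Gam :: "'k::field alg set" where
  "Gam \<equiv> Gamma_ideal n s"

lemma Gam_zero: "(\<lambda>p. 0) \<in> Gam"
  and Gam_add: "a \<in> Gam \<Longrightarrow> b \<in> Gam \<Longrightarrow> (\<lambda>p. a p + b p) \<in> Gam"
  and Gam_smult: "a \<in> Gam \<Longrightarrow> (\<lambda>p. c * a p) \<in> Gam"
  and Gam_lmult: "a \<in> Gam \<Longrightarrow> valid_path n m q \<Longrightarrow> amult n (delta q) a \<in> Gam"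
  and Gam_rmult: "a \<in> Gam \<Longrightarrow> valid_path n m q \<Longrightarrow> amult n a (delta q) \<in> Gam"
  unfolding Gamma_ideal_def
  by (blast intro: gen_ideal.intros)+

text \<open>Each relation vanishes for its own reason: a square repeats a label, the two paths of a
  commutativity relation are words of the same set, and alpha_0 alpha_1 falls under the default
  value of \<open>coef\<close>.\<close>

lemma Gam_imp_inkQ_coef:
  assumes "a \<in> Gam"
  shows "inkQ n m a \<and> (\<forall>x A. coef a x A = 0)"
  using assms unfolding Gamma_ideal_def
proof (induction rule: gen_ideal.induct)
  case (gen r)
  then consider (sq) x i where "r = delta (x, [i, i])" "valid_walk n m x [i, i]"
    | (com) x i j where "r = (\<lambda>p. delta (x, [i, j]) p - delta (x, [j, i]) p)" "i \<noteq> j"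
        "valid_walk n m x [i, j]" "valid_walk n m x [j]"
    | (bd) z where "r = delta (z, [0, 1])" "valid_walk n m z [0, 1]" "z ! 0 = 0"
    unfolding zz_rels_def by blast
  then show ?case
  proof cases
    case sq
    then show ?thesis by (auto simp: inkQ_delta valid_path_def coef_delta words_def)
  next
    case com
    \<comment> \<open>The relation only asks that [j] be valid at x; validity of all of [j, i]
      follows from the common endpoint.\<close>
    have "step (step x i) j = step (step x j) i"
      using walk_cong_set[of x "[i,j]" "[j,i]"] com by (auto dest: vert_length)
    then have "valid_walk n m x [j, i]" using com by auto
    then show ?thesis using com
      by (auto simp: inkQ_delta valid_path_def coef_delta words_def coef_diff intro!: inkQ_diff)
  next
    case bd
    then show ?thesis by (auto simp: inkQ_delta valid_path_def coef_delta words_def)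
  qed
next
  case (lmult a q)
  obtain y u where q: "q = (y, u)" by fastforce
  have "coef (amult n (delta q) a) x A = 0" for x A
    using lmult coef_amult_left[of x u a A] coef_amult_left_other[of x y u a A]
    by (cases "x = y") (auto simp: q valid_path_def)
  then show ?case using lmult inkQ_amult_delta_left by blast
next
  case (rmult a q)
  then show ?case using inkQ_amult_delta_right coef_amult_right_zero by blast
qed (auto simp: coef_add coef_smult inkQ_zero inkQ_add inkQ_smult)

section \<open>Reduction to sorted paths modulo the ideal\<close>

definition cong :: "'k::field alg \<Rightarrow> 'k alg \<Rightarrow> bool" where
  "cong a b \<longleftrightarrow> (\<lambda>p. a p - b p) \<in> Gam"

lemma cong_refl: "cong a a"
  by (simp add: cong_def Gam_zero)

lemma cong_trans: "cong a b \<Longrightarrow> cong b c \<Longrightarrow> cong a c"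
  unfolding cong_def using Gam_add[of "\<lambda>p. a p - b p" "\<lambda>p. b p - c p"] by simp

lemma cong_Gam: "cong a b \<Longrightarrow> b \<in> Gam \<Longrightarrow> a \<in> Gam"
  unfolding cong_def using Gam_add[of "\<lambda>p. a p - b p" b] by simp

lemma Gam_Cons:
  assumes "delta (step x i, w) \<in> (Gam :: 'k::field alg set)" "valid_walk n m x [i]"
  shows "delta (x, i # w) \<in> (Gam :: 'k::field alg set)"
  using Gam_lmult[OF assms(1), of "(x, [i])"] assms(2) amult_delta_delta[of x "[i]" w, where 'k='k]
  by (simp add: valid_path_def)

lemma cong_Cons:
  assumes "cong (delta (step x i, v)) (delta (step x i, w) :: 'k::field alg)" "valid_walk n m x [i]"
  shows "cong (delta (x, i # v)) (delta (x, i # w) :: 'k::field alg)"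
  using Gam_lmult[OF assms(1)[unfolded cong_def], of "(x, [i])"] assms(2)
    amult_delta_delta[of x "[i]" v, where 'k='k] amult_delta_delta[of x "[i]" w, where 'k='k]
  by (simp add: valid_path_def amult_diff_right cong_def)

lemma Gam_append:
  assumes "delta (x, u) \<in> (Gam :: 'k::field alg set)" "valid_walk n m (walk n x u) w"
  shows "delta (x, u @ w) \<in> (Gam :: 'k::field alg set)"
  using Gam_rmult[OF assms(1), of "(walk n x u, w)"] assms(2) amult_delta_delta[of x u w, where 'k='k]
  by (simp add: valid_path_def)

lemma cong_append:
  assumes "cong (delta (x, u)) (delta (x, v) :: 'k::field alg)" "walk n x u = walk n x v"
    "valid_walk n m (walk n x u) w"
  shows "cong (delta (x, u @ w)) (delta (x, v @ w) :: 'k::field alg)"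
  using Gam_rmult[OF assms(1)[unfolded cong_def], of "(walk n x u, w)"] assms(2,3)
    amult_delta_delta[of x u w, where 'k='k] amult_delta_delta[of x v w, where 'k='k]
  by (simp add: valid_path_def amult_diff_left cong_def)

lemma Gam_square: "valid_walk n m x [i, i] \<Longrightarrow> delta (x, [i, i]) \<in> Gam"
  unfolding Gamma_ideal_def zz_rels_def by (rule gen_ideal.gen) blast

lemma cong_swap:
  "valid_walk n m x [i, j] \<Longrightarrow> valid_walk n m x [j] \<Longrightarrow> i \<noteq> j \<Longrightarrow>
    cong (delta (x, [i, j])) (delta (x, [j, i]))"
  unfolding Gamma_ideal_def zz_rels_def cong_def by (rule gen_ideal.gen) blast

lemma Gam_boundary: "valid_walk n m x [0, 1] \<Longrightarrow> x ! 0 = 0 \<Longrightarrow> delta (x, [0, 1]) \<in> Gam"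
  unfolding Gamma_ideal_def zz_rels_def by (rule gen_ideal.gen) blast

text \<open>The unit at \<open>prd j\<close> that alpha_j consumes is missing at x but present after
  alpha_i, so alpha_i has put it there.\<close>

lemma swap_obstruction:
  assumes "valid_walk n m x [i, j]" "\<not> valid_walk n m x [j]" "i \<noteq> j"
  shows "i = prd j \<and> x ! prd j = 0"
proof -
  have x: "vert n m x" "i \<le> n" "j \<le> n" "vert n m (step x i)" "0 < step x i ! prd j"
    using assms(1) vert_step_iff by auto
  then have "x ! prd j \<le> 0" using assms(2) vert_step_iff[of x j] by auto
  moreover have "0 \<le> x ! prd j" using x prd_le vert_iff by blast
  ultimately show ?thesis
    using x prd_le[of j] vert_length[OF x(1)] by (auto simp: nth_step split: if_splits)
qed

text \<open>One insertion of insertion sort: i moves right past every smaller label, and meeting an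
  equal one gives a square, hence zero.\<close>

lemma insert_word:
  assumes "valid_walk n m x (i # v)" "sorted_wrt lt v"
  shows "delta (x, i # v) \<in> (Gam :: 'k::field alg set) \<or>
    (\<exists>w. sorted_wrt lt w \<and> valid_walk n m x w \<and> set w = insert i (set v)
       \<and> cong (delta (x, i # v)) (delta (x, w) :: 'k alg))"
  using assms
proof (induction v arbitrary: x)
  case Nil
  then show ?case using cong_refl by (intro disjI2 exI[of _ "[i]"]) auto
next
  case (Cons j v)
  have v2: "valid_walk n m x [i, j]" "valid_walk n m (walk n x [i, j]) v"
    using Cons.prems(1) by (auto dest: valid_walk_vert)
  consider "lt i j" | "i = j" | "lt j i" "i \<noteq> j" using lt_linear by blast
  then show ?case
  proof cases
    case 1
    have "sorted_wrt lt (i # j # v)" using 1 Cons.prems(2) lt_trans[OF 1] by auto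
    then show ?thesis using cong_refl Cons.prems(1) by (intro disjI2 exI[of _ "i # j # v"]) auto
  next
    case 2
    then show ?thesis using Gam_append[OF Gam_square, of x i v] v2 by auto
  next
    case 3
    show ?thesis
    proof (cases "valid_walk n m x [j]")
      case True
      have eq: "walk n x [i, j] = walk n x [j, i]"
        using True 3 by (intro walk_cong_set) (auto dest: vert_length)
      have c: "cong (delta (x, i # j # v)) (delta (x, j # i # v) :: 'k alg)"
        using cong_append[OF cong_swap eq, of v] True v2 3 by auto
      have "valid_walk n m (step x j) (i # v)"
        using v2 True eq by (auto dest: valid_walk_vert)
      from Cons.IH[OF this] Cons.prems(2) consider
        "delta (step x j, i # v) \<in> (Gam :: 'k alg set)"
        | w where "sorted_wrt lt w" "valid_walk n m (step x j) w" "set w = insert i (set v)"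
          "cong (delta (step x j, i # v)) (delta (step x j, w) :: 'k alg)" by auto
      then show ?thesis
      proof cases
        case 1
        then show ?thesis using cong_Gam[OF c] Gam_Cons True by blast
      next
        case (2 w)
        have "sorted_wrt lt (j # w)" using 2 3 Cons.prems(2) by auto
        moreover have "valid_walk n m x (j # w)" using 2 True by auto
        moreover have "cong (delta (x, i # j # v)) (delta (x, j # w) :: 'k alg)"
          using cong_trans[OF c cong_Cons] 2 True by blast
        ultimately show ?thesis using 2 by (intro disjI2 exI[of _ "j # w"]) auto
      qed
    next
      case False
      \<comment> \<open>The exchange is blocked: \<open>lt j i\<close> together with i =
        \<open>prd j\<close> leaves only i = 0, j = 1, the path killed where coordinate 0
        vanishes.\<close>
      then have "i = prd j" "x ! prd j = 0" using swap_obstruction v2 3 by auto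
      then have "i = 0" "j = 1" using 3 by (auto simp: lt_def prd_def split: if_splits)
      then show ?thesis
        using Gam_append[OF Gam_boundary, of x v] v2 \<open>x ! prd j = 0\<close> by (auto simp: prd_def)
    qed
  qed
qed

lemma sort_word:
  assumes "valid_walk n m x v"
  shows "delta (x, v) \<in> (Gam :: 'k::field alg set) \<or>
    (\<exists>w. sorted_wrt lt w \<and> valid_walk n m x w \<and> set w = set v
       \<and> cong (delta (x, v)) (delta (x, w) :: 'k alg))"
  using assms
proof (induction v arbitrary: x)
  case Nil
  then show ?case using cong_refl by (intro disjI2 exI[of _ "[]"]) auto
next
  case (Cons i v)
  have i: "valid_walk n m x [i]" using Cons.prems by (auto dest: valid_walk_vert)
  have "valid_walk n m (step x i) v" using Cons.prems by auto
  from Cons.IH[OF this] consider "delta (step x i, v) \<in> (Gam :: 'k alg set)"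
    | w where "sorted_wrt lt w" "valid_walk n m (step x i) w" "set w = set v"
      "cong (delta (step x i, v)) (delta (step x i, w) :: 'k alg)" by auto
  then show ?case
  proof cases
    case 1
    then show ?thesis using Gam_Cons i by blast
  next
    case (2 w)
    have c: "cong (delta (x, i # v)) (delta (x, i # w) :: 'k alg)" using cong_Cons 2 i by blast
    have "valid_walk n m x (i # w)" using 2 i by auto
    from insert_word[OF this 2(1), where 'k='k] show ?thesis
    proof
      assume "delta (x, i # w) \<in> (Gam :: 'k alg set)"
      then show ?thesis using cong_Gam[OF c] by blast
    next
      assume "\<exists>w'. sorted_wrt lt w' \<and> valid_walk n m x w' \<and> set w' = insert i (set w)
        \<and> cong (delta (x, i # w)) (delta (x, w') :: 'k alg)"
      then obtain w' where "sorted_wrt lt w'" "valid_walk n m x w'" "set w' = insert i (set w)"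
        "cong (delta (x, i # w)) (delta (x, w') :: 'k alg)" by blast
      then show ?thesis using cong_trans[OF c] 2(3) by (intro disjI2 exI[of _ w']) auto
    qed
  qed
qed

text \<open>A nonzero coordinate means that A has a word and the default case is excluded. That word
  has coordinate 1, so it is not in the ideal, and \<open>sort_word\<close> must return a sorted
  path instead of zero.\<close>

lemma sorted_word_exists:
  assumes "coef (a :: 'k::field alg) x A \<noteq> 0"
  obtains w where "sorted_wrt lt w" "w \<in> words x A"
proof -
  have good: "\<not> (1 \<in> A \<and> x ! 0 = 0)" using assms by (auto simp: coef_def)
  then obtain v where v: "v \<in> words x A" using assms unfolding coef_def
    by (metis sum.empty ex_in_conv)
  then have "coef (delta (x, v) :: 'k alg) x A \<noteq> 0" using good by (simp add: coef_delta)
  then have "delta (x, v) \<notin> (Gam :: 'k alg set)" using Gam_imp_inkQ_coef by blast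
  with sort_word[of x v] v obtain w where "sorted_wrt lt w" "valid_walk n m x w" "set w = set v"
    unfolding words_def by blast
  then show thesis using that[of w] v lt_sorted_distinct by (auto simp: words_def)
qed

text \<open>A label set has at most one sorted word (\<open>lt_sorted_unique\<close>), so a single
  term of the sum in \<open>coef\<close> survives.\<close>

lemma coef_sorted_support:
  assumes "\<And>v. a (x, v) \<noteq> 0 \<Longrightarrow> sorted_wrt lt v" "sorted_wrt lt w" "w \<in> words x A"
  shows "coef a x A = a (x, w)"
proof -
  \<comment> \<open>Label 1 is least, so a sorted word containing it starts with alpha_1, which
    needs a positive coordinate 0.\<close>
  have "\<not> (1 \<in> A \<and> x ! 0 = 0)"
  proof
    assume *: "1 \<in> A \<and> x ! 0 = 0"
    then have "1 \<in> set w" using assms(3) by (auto simp: words_def)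
    then obtain v where w: "w = 1 # v" using assms(2)
      by (cases w) (auto simp: lt_def)
    have "valid_walk n m x (1 # v)" using assms(3) by (simp add: words_def w)
    then have "vert n m x" "vert n m (step x 1)"
      by (auto dest: valid_walk_vert)
    then show False using vert_step_iff[of x 1] n_pos * by (auto simp: prd_def)
  qed
  then have "coef a x A = (\<Sum>v\<in>words x A. a (x, v))" by (auto simp: coef_def)
  also have "\<dots> = (\<Sum>v\<in>words x A. if v = w then a (x, w) else 0)"
  proof (rule sum.cong)
    fix v assume "v \<in> words x A"
    then have "set v = set w" using assms(3) by (simp add: words_def)
    then have "a (x, v) = 0" if "v \<noteq> w" using that assms(1,2) lt_sorted_unique by blast
    then show "a (x, v) = (if v = w then a (x, w) else 0)" by simp
  qed simp
  also have "\<dots> = a (x, w)" using finite_words[of x A] assms(3) by (simp add: sum.delta)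
  finally show ?thesis .
qed

lemma sorted_representative:
  assumes "inkQ n m (a :: 'k::field alg)"
  shows "\<exists>b. inkQ n m b \<and> (\<forall>x w. b (x, w) \<noteq> 0 \<longrightarrow> sorted_wrt lt w) \<and> cong a b"
proof -
  have "inkQ n m a \<Longrightarrow> {p. a p \<noteq> 0} = S \<Longrightarrow> ?thesis" if "finite S" for S
    using that
  proof (induction S arbitrary: a rule: finite_induct)
    case empty
    then have "a = (\<lambda>p. 0)" by auto
    then show ?case using inkQ_zero cong_refl by (intro exI[of _ "\<lambda>p. 0"]) auto
  next
    case (insert q S)
    obtain y u where q: "q = (y, u)" by fastforce
    define a' where "a' = (\<lambda>p. if p = q then 0 else a p)"
    have "{p. a' p \<noteq> 0} = S" using insert by (auto simp: a'_def)
    moreover have "inkQ n m a'" using insert(4) \<open>{p. a' p \<noteq> 0} = S\<close> \<open>finite S\<close>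
      by (auto simp: inkQ_def a'_def)
    ultimately obtain b where b: "inkQ n m b" "\<forall>x w. b (x, w) \<noteq> 0 \<longrightarrow> sorted_wrt lt w" "cong a' b"
      using insert.IH by blast
    have u: "valid_walk n m y u" using insert(4,5) by (auto simp: inkQ_def q valid_path_def)
    have *: "\<exists>e. inkQ n m e \<and> (\<forall>x w. e (x, w) \<noteq> 0 \<longrightarrow> sorted_wrt lt w) \<and> cong (delta q) (e :: 'k alg)"
      using sort_word[OF u, where 'k='k]
    proof
      assume "delta (y, u) \<in> (Gam :: 'k alg set)"
      then show ?thesis by (intro exI[of _ "\<lambda>p. 0"]) (auto simp: q inkQ_zero cong_def)
    next
      assume "\<exists>w. sorted_wrt lt w \<and> valid_walk n m y w \<and> set w = set u
        \<and> cong (delta (y, u)) (delta (y, w) :: 'k alg)"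
      then obtain w where "sorted_wrt lt w" "valid_walk n m y w"
        "cong (delta (y, u)) (delta (y, w) :: 'k alg)"
        by blast
      moreover have "\<forall>x v. delta (y, w) (x, v) \<noteq> (0 :: 'k) \<longrightarrow> sorted_wrt lt v"
        using \<open>sorted_wrt lt w\<close> by (simp add: delta_def)
      ultimately show ?thesis
        by (intro exI[of _ "delta (y, w)"]) (simp add: q inkQ_delta valid_path_def)
    qed
    then obtain e :: "'k alg" where e: "inkQ n m e" "\<forall>x w. e (x, w) \<noteq> 0 \<longrightarrow> sorted_wrt lt w" "cong (delta q) e"
      by blast
    have "(\<lambda>p. (a' p - b p) + a q * (delta q p - e p)) \<in> Gam"
      using b(3) e(3) unfolding cong_def by (intro Gam_add Gam_smult)
    moreover have "(\<lambda>p. (a' p - b p) + a q * (delta q p - e p)) = (\<lambda>p. a p - (b p + a q * e p))"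
      by (auto simp: fun_eq_iff a'_def delta_def algebra_simps)
    ultimately have "cong a (\<lambda>p. b p + a q * e p)"
      by (simp add: cong_def)
    moreover have "inkQ n m (\<lambda>p. b p + a q * e p)"
      using b(1) e(1) by (intro inkQ_add inkQ_smult)
    moreover have "\<forall>x w. b (x, w) + a q * e (x, w) \<noteq> 0 \<longrightarrow> sorted_wrt lt w"
      using b(2) e(2) by (metis add_0 mult_zero_right)
    ultimately show ?case by blast
  qed
  then show ?thesis using assms by (auto simp: inkQ_def)
qed

text \<open>The basis theorem: every element is congruent to a combination of sorted paths, whose
  coefficients are its coordinates, so vanishing coordinates leave only zero.\<close>

lemma Gam_iff: "a \<in> Gam \<longleftrightarrow> inkQ n m a \<and> (\<forall>x A. coef a x A = 0)"
proof (intro iffI)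
  assume a: "inkQ n m a \<and> (\<forall>x A. coef a x A = 0)"
  then obtain b where b: "inkQ n m b" "\<forall>x w. b (x, w) \<noteq> 0 \<longrightarrow> sorted_wrt lt w" "cong a b"
    using sorted_representative by blast
  have "coef b x A = 0" for x A
    using Gam_imp_inkQ_coef[OF b(3)[unfolded cong_def]] a by (auto simp: coef_diff)
  have "b = (\<lambda>p. 0)"
  proof (rule ccontr)
    assume "b \<noteq> (\<lambda>p. 0)"
    then obtain x w where "b (x, w) \<noteq> 0" by fastforce
    then have w: "sorted_wrt lt w" "w \<in> words x (set w)"
      using b lt_sorted_distinct by (auto simp: inkQ_def words_def valid_path_def)
    then have "coef b x (set w) = b (x, w)" using b(2) by (intro coef_sorted_support) auto
    then show False using \<open>b (x, w) \<noteq> 0\<close> \<open>\<And>x A. coef b x A = 0\<close> by simp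
  qed
  then show "a \<in> Gam" using b(3) by (simp add: cong_def)
qed (rule Gam_imp_inkQ_coef)

end

text \<open>The terms with j < k cancel those with k < j one by one. Comparing the sum with its
  negative would not suffice in characteristic 2.\<close>

lemma sum_antisym_zero:
  fixes f :: "'i::linorder \<Rightarrow> 'i \<Rightarrow> 'k::ab_group_add"
  assumes "finite S" and anti: "\<And>j k. j \<in> S \<Longrightarrow> k \<in> S \<Longrightarrow> j < k \<Longrightarrow> f k j = - f j k"
  shows "(\<Sum>j\<in>S. \<Sum>k\<in>S - {j}. f j k) = 0"
proof -
  let ?g = "\<lambda>j k. if j < k then f j k else 0"
  have "(\<Sum>j\<in>S. \<Sum>k\<in>S - {j}. f j k) = (\<Sum>j\<in>S. \<Sum>k\<in>S. ?g j k - ?g k j)"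
  proof (rule sum.cong)
    fix j assume j: "j \<in> S"
    have "(\<Sum>k\<in>S. ?g j k - ?g k j) = (\<Sum>k\<in>S - {j}. ?g j k - ?g k j)"
      using assms(1) j by (subst sum.remove[of S j]) auto
    also have "\<dots> = (\<Sum>k\<in>S - {j}. f j k)"
    proof (rule sum.cong)
      fix k assume "k \<in> S - {j}"
      then show "?g j k - ?g k j = f j k" using anti[of k j] j by (cases "j < k") auto
    qed simp
    finally show "(\<Sum>k\<in>S - {j}. f j k) = (\<Sum>k\<in>S. ?g j k - ?g k j)" by simp
  qed simp
  also have "\<dots> = (\<Sum>j\<in>S. \<Sum>k\<in>S. ?g j k) - (\<Sum>j\<in>S. \<Sum>k\<in>S. ?g k j)"
    by (simp add: sum_subtractf)
  also have "(\<Sum>j\<in>S. \<Sum>k\<in>S. ?g k j) = (\<Sum>j\<in>S. \<Sum>k\<in>S. ?g j k)"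
    by (rule sum.swap)
  finally show ?thesis by simp
qed

text \<open>The labels of B are 0 or larger than j, and 0 is last in the order, so j comes
  first.\<close>

lemma lt_sorted_head:
  assumes "sorted_wrt lt w" "set w = insert j B" "B \<inter> {1..j} = {}" "1 \<le> j"
  obtains v where "w = j # v" "set v = B" "sorted_wrt lt v"
proof -
  obtain i v where w: "w = i # v" using assms(2) by (cases w) auto
  have "i = j"
  proof (rule ccontr)
    assume "i \<noteq> j"
    then have "j \<in> set v" "i \<in> B" using assms(2) unfolding w by auto
    then have "i \<in> {1..j}" using assms(1,4) unfolding w by (auto simp: lt_def)
    then show False using \<open>i \<in> B\<close> assms(3) by blast
  qed
  moreover have "j \<notin> set v" using assms(1) unfolding w \<open>i = j\<close> by (auto simp: lt_def)
  moreover have "j \<notin> B" using assms(3,4) by auto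
  ultimately have "set v = B" using assms(2) unfolding w by auto
  then show thesis using that[of v] assms(1) w \<open>i = j\<close> by auto
qed

section \<open>The linear resolution\<close>

locale resolution = zigzag +
  fixes x :: "int list"
  assumes vert_x: "vert n m x"
begin

text \<open>A multi-exponent \<open>d\<close>, extended by zero outside \<open>{1..n}\<close>, indexes the summand
  \<open>P\<^bsub>y\<^esub>\<close> with \<open>y = x + d\<^sub>1f\<^sub>1 + \<dots> + d\<^sub>nf\<^sub>n\<close> in homological degree \<open>d\<^sub>1 + \<dots> + d\<^sub>n\<close>.\<close>

definition box :: "(nat \<Rightarrow> nat) set" where
  "box = {d. (\<forall>k. k \<notin> {1..n} \<longrightarrow> d k = 0) \<and> (\<forall>k\<in>{1..n}. int (d k) \<le> x ! (k - 1))}"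

definition deg :: "(nat \<Rightarrow> nat) \<Rightarrow> nat" where
  "deg d = (\<Sum>k=1..n. d k)"

definition idx :: "nat \<Rightarrow> (nat \<Rightarrow> nat) set" where
  "idx i = {d \<in> box. deg d = i}"

definition up :: "(nat \<Rightarrow> nat) \<Rightarrow> nat \<Rightarrow> nat \<Rightarrow> nat" where
  "up d j = d(j := Suc (d j))"

text \<open>Coordinate k gains d_k from f_k and loses d_(k+1) to f_(k+1); on \<open>box\<close>, d_0
  = d_(n+1) = 0 covers both ends.\<close>

definition yv :: "(nat \<Rightarrow> nat) \<Rightarrow> int list" where
  "yv d = map (\<lambda>k. x ! k + int (d k) - int (d (Suc k))) [0..<Suc n]"

definition mn :: "(nat \<Rightarrow> nat) \<Rightarrow> nat" where
  "mn d = (LEAST k. d k \<noteq> 0)"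

text \<open>The Koszul sign of the tensor product: one sign for each unit of exponent before
  j.\<close>

definition sg :: "(nat \<Rightarrow> nat) \<Rightarrow> nat \<Rightarrow> 'k::field" where
  "sg d j = (-1) ^ (\<Sum>l<j. d l)"

text \<open>The differential acting on coordinate functions, hence transposed: the value at (d, A)
  collects the coefficients of all pairs that are sent to (d, A).\<close>

definition dd :: "((nat \<Rightarrow> nat) \<Rightarrow> nat set \<Rightarrow> 'k::field) \<Rightarrow> (nat \<Rightarrow> nat) \<Rightarrow> nat set \<Rightarrow> 'k" where
  "dd V d A = (\<Sum>j\<in>{1..n} \<inter> A. sg d j * V (up d j) (A - {j}))"

text \<open>Contracting homotopy: with \<open>j\<close> the least index in the support of \<open>d\<close> or in \<open>A - {0}\<close>, it moves
  \<open>j\<close> from the label set \<open>A\<close> into the exponent \<open>d\<close>. Here it acts on coordinates, so \<open>j\<close> is moved back.\<close>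

definition htp :: "((nat \<Rightarrow> nat) \<Rightarrow> nat set \<Rightarrow> 'k::field) \<Rightarrow> (nat \<Rightarrow> nat) \<Rightarrow> nat set \<Rightarrow> 'k" where
  "htp V d A = (if d \<in> box \<and> d \<noteq> (\<lambda>_. 0) \<and> A \<inter> {1..mn d} = {}
     then V (d(mn d := d (mn d) - 1)) (insert (mn d) A) else 0)"

text \<open>Families that can be coordinates of elements of the free modules: a label set without a
  sorted word at \<open>yv d\<close> carries no basis vector there.\<close>

definition admissible :: "((nat \<Rightarrow> nat) \<Rightarrow> nat set \<Rightarrow> 'k::field) \<Rightarrow> bool" where
  "admissible V \<longleftrightarrow> (\<forall>d A. V d A \<noteq> 0 \<longrightarrow>
     d \<in> box \<and> A \<subseteq> {..n} \<and> (\<exists>w\<in>words (yv d) A. sorted_wrt lt w))"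

lemma mn_nonzero: "d \<noteq> (\<lambda>_. 0) \<Longrightarrow> d (mn d) \<noteq> 0"
  unfolding mn_def by (rule LeastI_ex) auto

lemma mn_eqI: "d j \<noteq> 0 \<Longrightarrow> (\<And>l. l < j \<Longrightarrow> d l = 0) \<Longrightarrow> mn d = j"
  unfolding mn_def by (rule Least_equality) (auto simp: not_less[symmetric])

lemma mn_range: "d \<in> box \<Longrightarrow> d \<noteq> (\<lambda>_. 0) \<Longrightarrow> mn d \<in> {1..n}"
  using mn_nonzero[of d] by (auto simp: box_def)

lemma up_box: "up d j \<in> box \<Longrightarrow> j \<in> {1..n} \<Longrightarrow> d \<in> box"
  unfolding box_def up_def by (auto split: if_splits)

lemma deg_up: "j \<in> {1..n} \<Longrightarrow> deg (up d j) = Suc (deg d)"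
proof -
  assume j: "j \<in> {1..n}"
  have "deg (up d j) = (\<Sum>k=1..n. d k + (if k = j then 1 else 0))"
    unfolding deg_def up_def by (rule sum.cong) auto
  then show ?thesis using j by (simp add: sum.distrib deg_def)
qed

lemma up_idx: "j \<in> {1..n} \<Longrightarrow> up d j \<in> idx (Suc i) \<Longrightarrow> d \<in> idx i"
  using up_box deg_up by (auto simp: idx_def)

lemma up_not_zero: "up d j \<noteq> (\<lambda>_. 0)"
  by (metis fun_upd_same nat.distinct(1) up_def)

lemma finite_box: "finite box"
proof -
  have "box \<subseteq> {d. \<forall>k. (k \<in> {1..n} \<longrightarrow> d k \<in> {..nat (Max (set x))}) \<and> (k \<notin> {1..n} \<longrightarrow> d k = 0)}"
  proof
    fix d assume d: "d \<in> box"
    have "d k \<le> nat (Max (set x))" if "k \<in> {1..n}" for k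
    proof -
      have "x ! (k - 1) \<in> set x" using that vert_length[OF vert_x] by (intro nth_mem) auto
      then have "x ! (k - 1) \<le> Max (set x)" by simp
      then show ?thesis using d that by (force simp: box_def)
    qed
    then show "d \<in> {d. \<forall>k. (k \<in> {1..n} \<longrightarrow> d k \<in> {..nat (Max (set x))}) \<and> (k \<notin> {1..n} \<longrightarrow> d k = 0)}"
      using d by (auto simp: box_def)
  qed
  moreover have "finite {d. \<forall>k. (k \<in> {1..n} \<longrightarrow> d k \<in> {..nat (Max (set x))}) \<and> (k \<notin> {1..n} \<longrightarrow> d k = (0::nat))}"
    by (rule finite_set_of_finite_funs) auto
  ultimately show ?thesis by (rule finite_subset)
qed

lemma finite_idx: "finite (idx i)"
  using finite_box by (simp add: idx_def)

lemma length_yv [simp]: "length (yv d) = Suc n"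
  by (simp add: yv_def)

lemma nth_yv: "k \<le> n \<Longrightarrow> yv d ! k = x ! k + int (d k) - int (d (Suc k))"
  unfolding yv_def by (subst nth_map) (auto simp del: upt_Suc)

text \<open>The changes telescope, and the bound d_(k+1) <= x_k lets x alone pay for what coordinate
  k loses.\<close>

lemma vert_yv:
  assumes "d \<in> box"
  shows "vert n m (yv d)"
proof -
  have x: "\<And>k. k \<le> n \<Longrightarrow> 0 \<le> x ! k" "(\<Sum>k\<le>n. x ! k) = int s"
    using vert_x by (auto simp: vert_iff)
  have d: "d 0 = 0" "d (Suc n) = 0" "\<And>k. k < n \<Longrightarrow> int (d (Suc k)) \<le> x ! k"
    using assms by (force simp: box_def)+
  have "(\<Sum>k\<le>n. yv d ! k) = (\<Sum>k\<le>n. x ! k + (int (d k) - int (d (Suc k))))"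
    by (rule sum.cong) (auto simp: nth_yv)
  also have "\<dots> = (\<Sum>k\<le>n. x ! k) + (\<Sum>k\<le>n. int (d k) - int (d (Suc k)))"
    by (simp only: sum.distrib)
  also have "(\<Sum>k\<le>n. int (d k) - int (d (Suc k))) = 0"
    by (subst sum_telescope) (simp add: d)
  finally have "(\<Sum>k\<le>n. yv d ! k) = int s" using x by simp
  moreover have "0 \<le> yv d ! k" if "k \<le> n" for k
    using that x(1)[of k] d(2) d(3)[of k] by (cases "k = n") (auto simp: nth_yv)
  ultimately show ?thesis by (simp add: vert_iff)
qed

lemma yv_zero: "yv (\<lambda>_. 0) = x"
  using vert_length[OF vert_x] by (intro nth_equalityI) (auto simp: nth_yv)

lemma yv_up: "j \<in> {1..n} \<Longrightarrow> yv (up d j) = step (yv d) j"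
  by (rule nth_equalityI) (auto simp: nth_yv nth_step up_def prd_def)

lemma up_valid: "j \<in> {1..n} \<Longrightarrow> up d j \<in> box \<Longrightarrow> valid_walk n m (yv d) [j]"
  using vert_yv[of d] vert_yv[of "up d j"] up_box yv_up by auto

lemma up_box_iff:
  assumes "j \<in> {1..n}" "d \<in> box"
  shows "up d j \<in> box \<longleftrightarrow> int (d j) < x ! (j - 1)"
  using assms by (auto simp: box_def up_def)

text \<open>The homotopy stays inside the box: the sorted word of A starts with j, so coordinate j -
  1 of \<open>yv d\<close> is positive, and as d_(j-1) = 0 this coordinate is x_(j-1) - d_j.\<close>

lemma admissible_up_box:
  assumes V: "admissible V" "V d A \<noteq> 0" and j: "j \<in> {1..n}" "j \<in> A" "A \<inter> {1..<j} = {}"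
    and d: "\<And>l. l < j \<Longrightarrow> d l = 0"
  shows "up d j \<in> box"
proof -
  obtain w where w: "w \<in> words (yv d) A" "sorted_wrt lt w" and db: "d \<in> box"
    using V unfolding admissible_def by blast
  have "set w = insert j (A - {j})" using w(1) j(2) by (auto simp: words_def)
  moreover have "(A - {j}) \<inter> {1..j} = {}" using j(3) by force
  ultimately obtain v where v: "w = j # v" using lt_sorted_head w(2) j(1) by (metis atLeastAtMost_iff)
  have "valid_walk n m (yv d) (j # v)" using w(1) v by (simp add: words_def)
  then have "vert n m (step (yv d) j)" by (auto dest: valid_walk_vert)
  then have "0 < yv d ! (j - 1)" using vert_step_iff[OF vert_yv[OF db], of j] j(1) by (simp add: prd_def)
  then have "int (d j) < x ! (j - 1)" using j(1) d[of "j - 1"] by (cases j) (auto simp: nth_yv)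
  then show ?thesis using up_box_iff[OF j(1) db] by simp
qed

text \<open>The term of j returns V d A with sign 1. For k > j the label j stays in A - {k} and is
  at most \<open>mn (up d k)\<close>, so the guard of \<open>htp\<close> makes that term
  zero.\<close>

lemma dd_htp_in:
  assumes V: "admissible V" and j: "j \<in> {1..n}" "j \<in> A" "A \<inter> {1..<j} = {}"
    and d: "\<And>l. l < j \<Longrightarrow> d l = 0"
  shows "dd (htp V) d A = V d A"
proof -
  have "sg d k * htp V (up d k) (A - {k}) = (if k = j then V d A else 0)"
    if k: "k \<in> {1..n} \<inter> A" for k
  proof (cases "k = j")
    case True
    have "mn (up d j) = j" using d by (intro mn_eqI) (auto simp: up_def)
    moreover have "(A - {j}) \<inter> {1..j} = {}" using j(3) by force
    moreover have "(up d j)(j := up d j j - 1) = d" by (auto simp: up_def)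
    moreover have "sg d j = (1 :: 'a)" using d by (simp add: sg_def)
    ultimately show ?thesis using True j(2) admissible_up_box[OF V _ j d] up_not_zero[of d j]
      by (auto simp: htp_def insert_absorb)
  next
    case False
    then have "j < k" using k j(3) by force
    have "\<not> mn (up d k) < j"
    proof
      assume *: "mn (up d k) < j"
      then have "up d k (mn (up d k)) = 0" using d \<open>j < k\<close> by (auto simp: up_def)
      then show False using mn_nonzero up_not_zero by blast
    qed
    then have "j \<in> (A - {k}) \<inter> {1..mn (up d k)}" using False j by auto
    then have "htp V (up d k) (A - {k}) = 0" unfolding htp_def by auto
    then show ?thesis using False by simp
  qed
  then have "dd (htp V) d A = (\<Sum>k\<in>{1..n} \<inter> A. if k = j then V d A else 0)"
    unfolding dd_def by (rule sum.cong[OF refl])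
  also have "\<dots> = V d A" using j by (simp add: sum.delta)
  finally show ?thesis .
qed

text \<open>The homotopy identity at (d, A). In the vanishing sum \<open>dd V\<close> at (d - e_j, A
  + {j}) the term of j is V d A; the other terms are those of \<open>dd (htp V) d A\<close> with
  opposite sign, because lowering d_j by one flips every sign behind j.\<close>

lemma dd_htp_out:
  assumes V: "admissible V" and db: "d \<in> box" and j: "A \<inter> {1..j} = {}" "d j \<noteq> 0"
    and d: "\<And>l. l < j \<Longrightarrow> d l = 0"
    and cycle: "dd V (d(j := d j - 1)) (insert j A) = 0"
  shows "dd (htp V) d A = V d A"
proof -
  define d0 where "d0 = d(j := d j - 1)"
  have jn: "j \<in> {1..n}" using db j(2) by (auto simp: box_def)
  have d0: "up d0 j = d" using j(2) by (auto simp: up_def d0_def)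
  have "sg d k * htp V (up d k) (A - {k}) = - (sg d0 k * V (up d0 k) (insert j A - {k}))"
    if k: "k \<in> {1..n} \<inter> A" for k
  proof -
    have jk: "j < k" using k j(1) jn by (metis IntD1 IntD2 IntI atLeastAtMost_iff empty_iff not_less)
    have mn: "mn (up d k) = j" using d j(2) jk by (intro mn_eqI) (auto simp: up_def)
    have "(\<Sum>l<k. d l) = Suc (\<Sum>l<k. d0 l)"
      using j(2) jk by (simp add: sum.remove[of "{..<k}" j] d0_def)
    then have sg: "sg d k = - (sg d0 k :: 'a)" by (simp add: sg_def)
    \<comment> \<open>Raising the exponent at k leaves the box for d exactly when it does for
      \<open>d0\<close>: the bound at k only sees their common value d_k.\<close>
    have "up d k \<in> box \<longleftrightarrow> int (d k) < x ! (k - 1)" using up_box_iff db k by auto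
    moreover have "d0 \<in> box" using up_box d0 db jn by metis
    then have "up d0 k \<in> box \<longleftrightarrow> int (d k) < x ! (k - 1)" using up_box_iff k jk by (auto simp: d0_def)
    moreover have "V (up d0 k) (insert j A - {k}) = 0" if "up d0 k \<notin> box"
      using V that unfolding admissible_def by blast
    moreover have "(up d k)(j := up d k j - 1) = up d0 k" "insert j (A - {k}) = insert j A - {k}"
      using jk by (auto simp: up_def d0_def)
    moreover have "(A - {k}) \<inter> {1..j} = {}" using j(1) by auto
    ultimately have "htp V (up d k) (A - {k}) = V (up d0 k) (insert j A - {k})"
      using up_not_zero[of d k] by (auto simp: htp_def mn)
    then show ?thesis by (simp add: sg)
  qed
  then have "dd (htp V) d A = - (\<Sum>k\<in>{1..n} \<inter> A. sg d0 k * V (up d0 k) (insert j A - {k}))"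
    unfolding dd_def by (simp add: sum_negf)
  moreover have "dd V d0 (insert j A) =
    V d A + (\<Sum>k\<in>{1..n} \<inter> A. sg d0 k * V (up d0 k) (insert j A - {k}))"
  proof -
    have jA: "j \<notin> A" using j(1) jn by auto
    have "{1..n} \<inter> insert j A = insert j ({1..n} \<inter> A)" using jn by auto
    moreover have "sg d0 j = (1 :: 'a)" using d by (simp add: sg_def d0_def)
    moreover have "insert j A - {j} = A" using jA by auto
    ultimately show ?thesis using jA d0 by (simp add: dd_def)
  qed
  ultimately show ?thesis using cycle unfolding d0_def[symmetric] by (simp add: add_eq_0_iff2)
qed

lemma sg_up: "sg (up d j) k = (if j < k then - sg d k else sg d k :: 'k::field)"
proof (cases "j < k")
  case True
  then have "(\<Sum>l<k. up d j l) = Suc (\<Sum>l<k. d l)"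
    by (simp add: sum.remove[of "{..<k}" j] up_def)
  then show ?thesis using True by (simp add: sg_def)
next
  case False
  then have "(\<Sum>l<k. up d j l) = (\<Sum>l<k. d l)" by (intro sum.cong) (auto simp: up_def)
  then show ?thesis using False by (simp add: sg_def)
qed

text \<open>Treating j and k in either order reaches the same exponent and label set, but raising
  the smaller index first flips the sign of the larger.\<close>

lemma dd_dd: "dd (dd V) d A = (0 :: 'k::field)"
proof -
  define S where "S = {1..n} \<inter> A"
  define f where "f j k = sg d j * (sg (up d j) k * V (up (up d j) k) (A - {j} - {k}))" for j k
  have "dd (dd V) d A = (\<Sum>j\<in>S. \<Sum>k\<in>S - {j}. f j k)"
    unfolding dd_def S_def f_def
    by (intro sum.cong refl) (auto simp: sum_distrib_left Int_Diff)
  also have "\<dots> = 0"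
  proof (rule sum_antisym_zero)
    fix j k :: nat assume "j < k"
    moreover from this have "up (up d j) k = up (up d k) j" by (auto simp: up_def)
    moreover have "A - {j} - {k} = A - {k} - {j}" by auto
    ultimately show "f k j = - f j k" by (simp add: f_def sg_up)
  qed (simp add: S_def)
  finally show ?thesis .
qed

end

section \<open>Linearity of products, submodules, and arrows in coordinates\<close>

context zigzag
begin

lemma amult_sum_left:
  "amult n (\<lambda>p. \<Sum>j\<in>S. c j * f j p) b p = (\<Sum>j\<in>S. c j * amult n (f j) b p)"
proof -
  obtain y w where p: "p = (y, w)" by fastforce
  show ?thesis unfolding amult_def p prod.case
    by (simp add: sum_distrib_right sum_distrib_left mult.assoc) (rule sum.swap)
qed

lemma amult_sum_right:
  "amult n a (\<lambda>p. \<Sum>j\<in>S. c j * f j p) p = (\<Sum>j\<in>S. c j * amult n a (f j) p)"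
proof -
  obtain y w where p: "p = (y, w)" by fastforce
  show ?thesis unfolding amult_def p prod.case
    by (simp add: sum_distrib_left mult.left_commute) (rule sum.swap)
qed

lemma amult_id: "src_is x a \<Longrightarrow> amult n (delta (x, [])) a = a"
  by (auto simp: fun_eq_iff amult_delta_left src_is_def)

lemma src_is_amult:
  assumes "src_is x a"
  shows "src_is x (amult n a b)"
  unfolding src_is_def
proof (intro allI impI)
  fix p assume *: "amult n a b p \<noteq> 0"
  obtain y w where p: "p = (y, w)" by fastforce
  have "amult n a b p = 0" if "y \<noteq> x"
    using assms that unfolding amult_def p prod.case src_is_def
    by (intro sum.neutral) (metis fst_conv mult_zero_left)
  then show "fst p = x" using * p by auto
qed

lemma coef_other_source: "src_is y a \<Longrightarrow> z \<noteq> y \<Longrightarrow> coef a z A = 0"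
  unfolding coef_def src_is_def by (auto intro!: sum.neutral)

lemma Gam_iff_source:
  "inkQ n m a \<Longrightarrow> src_is y a \<Longrightarrow> a \<in> Gam \<longleftrightarrow> (\<forall>A. coef a y A = 0)"
  using Gam_iff coef_other_source by metis

text \<open>If 1 is in A and coordinate 0 of x vanishes, then j is not 1, so the arrow leaves
  coordinate 0 unchanged and the default value 0 applies on both sides. Hence the differential has
  one formula at all vertices.\<close>

lemma coef_arrow:
  assumes j: "j \<in> {1..n}" and v: "valid_walk n m x [j]"
  shows "coef (amult n (delta (x, [j])) a) x A =
    (if j \<in> A then coef a (step x j) (A - {j}) else 0)"
proof (cases "1 \<in> A \<and> x ! 0 = 0 \<and> j \<in> A")
  case True
  have x: "vert n m x" using v by simp
  have "j \<noteq> 1"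
  proof
    assume "j = 1"
    then have "0 < x ! 0" using v vert_step_iff[OF x, of j] j by (simp add: prd_def)
    then show False using True by simp
  qed
  then have "step x j ! 0 = 0" using True j vert_length[OF x] by (simp add: nth_step prd_def)
  then have "coef a (step x j) (A - {j}) = 0" using True \<open>j \<noteq> 1\<close> by (auto simp: coef_def)
  then show ?thesis using coef_amult_left[OF v, of a A] True by simp
next
  case False
  then show ?thesis using coef_amult_left[OF v, of a A] by auto
qed

lemma right_submod_sum:
  assumes U: "right_submod n m U" and S: "finite S" "\<And>i. i \<in> S \<Longrightarrow> f i \<in> U"
  shows "(\<lambda>p. \<Sum>i\<in>S. f i p) \<in> U"
  using S
proof (induction S rule: finite_induct)
  case empty
  then show ?case using U by (simp add: right_submod_def)
next
  case (insert i S)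
  then have "f i \<in> U" "(\<lambda>p. \<Sum>i\<in>S. f i p) \<in> U" by auto
  then have "(\<lambda>p. f i p + (\<Sum>i\<in>S. f i p)) \<in> U" using U by (simp add: right_submod_def)
  then show ?case using insert.hyps by simp
qed

lemma right_submod_amult:
  assumes U: "right_submod n m U" and a: "a \<in> U" and b: "inkQ n m b"
  shows "amult n a b \<in> U"
proof -
  let ?S = "{q. b q \<noteq> 0}"
  have fin: "finite ?S" using b by (simp add: inkQ_def)
  have "b = (\<lambda>p. \<Sum>q\<in>?S. b q * delta q p)"
  proof
    fix p
    have "(\<Sum>q\<in>?S. b q * delta q p) = (\<Sum>q\<in>?S. if q = p then b p else 0)"
      by (rule sum.cong) (auto simp: delta_def)
    then show "b p = (\<Sum>q\<in>?S. b q * delta q p)" using fin by simp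
  qed
  then have "amult n a b = amult n a (\<lambda>p. \<Sum>q\<in>?S. b q * delta q p)" by simp
  also have "\<dots> = (\<lambda>p. \<Sum>q\<in>?S. b q * amult n a (delta q) p)"
    by (rule ext) (rule amult_sum_right)
  also have "\<dots> \<in> U"
    using a U b by (intro right_submod_sum[OF U fin]) (auto simp: right_submod_def inkQ_def)
  finally show ?thesis .
qed

end

context resolution
begin

text \<open>Multidegree zero cannot be contracted, so \<open>V0\<close> asks that V vanish there; in
  homological degree 0 this is where the kernel of P_x -> Delta_x enters.\<close>

lemma dd_htp:
  assumes V: "admissible V" and cycle: "\<And>d A. dd V d A = 0"
    and V0: "\<And>A. A \<inter> {1..n} = {} \<Longrightarrow> V (\<lambda>_. 0) A = 0"
  shows "dd (htp V) d A = V d A"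
proof (cases "d \<in> box")
  case False
  have "htp V (up d j) (A - {j}) = 0" if "j \<in> {1..n} \<inter> A" for j
    using up_box[of d j] that False by (auto simp: htp_def)
  then have "dd (htp V) d A = 0" unfolding dd_def by (intro sum.neutral) auto
  then show ?thesis using V False unfolding admissible_def by metis
next
  case db: True
  let ?T = "\<lambda>j. j \<in> {1..n} \<and> (d j \<noteq> 0 \<or> j \<in> A)"
  show ?thesis
  proof (cases "\<exists>j. ?T j")
    case False
    then have "d = (\<lambda>_. 0)" "A \<inter> {1..n} = {}" using db by (auto simp: box_def fun_eq_iff)
    moreover from this have "dd (htp V) d A = 0" by (simp add: dd_def Int_commute)
    ultimately show ?thesis using V0 by simp
  next
    case True
    define j where "j = (LEAST j. ?T j)"
    have j: "?T j" unfolding j_def using True by (rule LeastI_ex)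
    have less: "\<not> ?T l" if "l < j" for l using that not_less_Least unfolding j_def by blast
    have d0: "d l = 0" if "l < j" for l
      using less[OF that] that j db by (cases "l = 0") (auto simp: box_def)
    have A0: "A \<inter> {1..<j} = {}" using less j by auto
    show ?thesis
    proof (cases "j \<in> A")
      case True
      then show ?thesis using dd_htp_in[OF V _ True A0, of d] d0 j by blast
    next
      case False
      have "A \<inter> {1..j} = {}"
      proof -
        have "{1..j} \<subseteq> insert j {1..<j}" by auto
        then show ?thesis using A0 False by blast
      qed
      then show ?thesis using dd_htp_out[OF V db, of A j] d0 cycle j False by blast
    qed
  qed
qed

section \<open>The free modules, the differential matrices and their coordinates\<close>

definition dl :: "nat \<Rightarrow> (nat \<Rightarrow> nat) list" where
  "dl i = (SOME l. distinct l \<and> set l = idx i)"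

definition L :: "nat \<Rightarrow> int list list" where
  "L i = map yv (dl i)"

definition pos :: "nat \<Rightarrow> (nat \<Rightarrow> nat) \<Rightarrow> nat" where
  "pos i d = (SOME b. b < length (dl i) \<and> dl i ! b = d)"

text \<open>At most one j qualifies, so an entry is a signed arrow or 0; left multiplication by
  alpha_j is the map from the projective at y + f_j to the one at y.\<close>

definition Dif :: "nat \<Rightarrow> nat \<Rightarrow> nat \<Rightarrow> 'k::field alg" where
  "Dif i a b = (\<lambda>p. \<Sum>j | j \<in> {1..n} \<and> dl i ! b = up (dl (i - 1) ! a) j.
     sg (dl (i - 1) ! a) j * delta (yv (dl (i - 1) ! a), [j]) p)"

definition dmap :: "nat \<Rightarrow> (nat \<Rightarrow> 'k::field alg) \<Rightarrow> nat \<Rightarrow> 'k alg" where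
  "dmap i = matapp n (Dif i) (length (L (i - 1))) (length (L i))"

text \<open>Coordinates of a lifted element of \<open>P\<^sup>i\<close>, extended by zero to all exponents.\<close>

definition fam :: "nat \<Rightarrow> (nat \<Rightarrow> 'k::field alg) \<Rightarrow> (nat \<Rightarrow> nat) \<Rightarrow> nat set \<Rightarrow> 'k" where
  "fam i v d A = (if d \<in> idx i then coef (v (pos i d)) (yv d) A else 0)"

text \<open>An element with coordinates \<open>htp V\<close>, supported on sorted paths so that each
  coordinate is one coefficient. Sortedness of \<open>j # w\<close> also encodes the guard of
  \<open>htp\<close> that w avoids 1, ..., j.\<close>

definition lift :: "nat \<Rightarrow> ((nat \<Rightarrow> nat) \<Rightarrow> nat set \<Rightarrow> 'k::field) \<Rightarrow> nat \<Rightarrow> 'k alg" where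
  "lift i V b = (\<lambda>(y, w). let d = dl i ! b; j = mn d in
     if b < length (dl i) \<and> y = yv d \<and> sorted_wrt lt (j # w) \<and> valid_walk n m y w
     then V (d(j := d j - 1)) (insert j (set w)) else 0)"

lemma dl: "distinct (dl i)" "set (dl i) = idx i"
  using someI_ex[of "\<lambda>l. distinct l \<and> set l = idx i"] finite_distinct_list[OF finite_idx[of i]]
  unfolding dl_def by blast+

lemma length_L [simp]: "length (L i) = length (dl i)"
  and nth_L: "b < length (dl i) \<Longrightarrow> L i ! b = yv (dl i ! b)"
  by (auto simp: L_def)

lemma dl_idx: "b < length (dl i) \<Longrightarrow> dl i ! b \<in> idx i"
  using dl(2) nth_mem by blast

lemma dl_box: "b < length (dl i) \<Longrightarrow> dl i ! b \<in> box"
  using dl_idx by (simp add: idx_def)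

lemma pos:
  assumes "d \<in> idx i"
  shows "pos i d < length (dl i)" "dl i ! pos i d = d"
proof -
  have "\<exists>b. b < length (dl i) \<and> dl i ! b = d" using assms dl(2) by (metis in_set_conv_nth)
  then show "pos i d < length (dl i)" "dl i ! pos i d = d"
    unfolding pos_def using someI_ex[of "\<lambda>b. b < length (dl i) \<and> dl i ! b = d"] by blast+
qed

lemma pos_nth: "b < length (dl i) \<Longrightarrow> pos i (dl i ! b) = b"
  using pos[OF dl_idx] dl(1) nth_eq_iff_index_eq by metis

lemma sum_dl_delta:
  "(\<Sum>b<length (dl i). if dl i ! b = d then t else 0) = (if d \<in> idx i then t else (0::'k::field))"
proof (cases "d \<in> idx i")
  case True
  have "(\<Sum>b<length (dl i). if dl i ! b = d then t else 0) =
    (\<Sum>b<length (dl i). if b = pos i d then t else 0)"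
    using pos[OF True] pos_nth by (intro sum.cong) auto
  then show ?thesis using pos[OF True] True by (simp add: sum.delta)
next
  case False
  then show ?thesis using dl_idx by (auto intro!: sum.neutral)
qed

lemma Dif_arrow:
  assumes "a < length (dl i)" "b < length (dl (Suc i))" "Dif (Suc i) a b p \<noteq> (0 :: 'k::field)"
  obtains j where "j \<in> {1..n}" "dl (Suc i) ! b = up (dl i ! a) j" "p = (yv (dl i ! a), [j])"
proof -
  from assms(3) obtain j where "j \<in> {j. j \<in> {1..n} \<and> dl (Suc i) ! b = up (dl i ! a) j}"
    "sg (dl i ! a) j * delta (yv (dl i ! a), [j]) p \<noteq> (0 :: 'k)"
    unfolding Dif_def diff_Suc_1 by (rule sum.not_neutral_contains_not_neutral)
  then show thesis using that[of j] by (auto simp: delta_def split: if_splits)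
qed

lemma lin_map_Dif: "lin_map n m (L i) (L (Suc i)) (Dif (Suc i))"
  unfolding lin_map_def length_L
proof (intro allI impI)
  fix a b assume ab: "a < length (dl i)" "b < length (dl (Suc i))"
  have "inkQ n m (Dif (Suc i) a b)"
    unfolding Dif_def
    using ab up_valid dl_box[OF ab(2)]
    by (intro inkQ_sum inkQ_smult) (auto simp: inkQ_delta valid_path_def)
  moreover have "src_is (L i ! a) (Dif (Suc i) a b)"
    unfolding src_is_def using Dif_arrow[OF ab] ab by (metis fst_conv nth_L)
  moreover have "tgt_is n (L (Suc i) ! b) (Dif (Suc i) a b)"
    unfolding tgt_is_def
  proof (intro allI impI)
    fix p assume "Dif (Suc i) a b p \<noteq> 0"
    then obtain j where "j \<in> {1..n}" "dl (Suc i) ! b = up (dl i ! a) j" "p = (yv (dl i ! a), [j])"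
      using Dif_arrow[OF ab] by blast
    then show "ptgt n p = L (Suc i) ! b" using ab by (simp add: ptgt_def nth_L yv_up)
  qed
  moreover have "homog 1 (Dif (Suc i) a b)"
    unfolding homog_def using Dif_arrow[OF ab] by fastforce
  ultimately show "inkQ n m (Dif (Suc i) a b) \<and> src_is (L i ! a) (Dif (Suc i) a b) \<and>
    tgt_is n (L (Suc i) ! b) (Dif (Suc i) a b) \<and> homog 1 (Dif (Suc i) a b)" by blast
qed

lemma dmap_eq:
  assumes "a < length (dl i)"
  shows "dmap (Suc i) u a = (\<lambda>p. \<Sum>b<length (dl (Suc i)).
    \<Sum>j | j \<in> {1..n} \<and> dl (Suc i) ! b = up (dl i ! a) j.
      sg (dl i ! a) j * amult n (delta (yv (dl i ! a), [j])) (u b) p)"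
  using assms unfolding dmap_def matapp_def Dif_def by (simp add: amult_sum_left)

lemma dmap_inkQ_src:
  assumes "in_free n m (L (Suc i)) u" "a < length (dl i)"
  shows "inkQ n m (dmap (Suc i) u a)" "src_is (L i ! a) (dmap (Suc i) u a)"
proof -
  show "inkQ n m (dmap (Suc i) u a)"
    unfolding dmap_eq[OF assms(2)]
  proof (intro inkQ_sum inkQ_smult inkQ_amult_delta_left)
    fix b j assume *: "b \<in> {..<length (dl (Suc i))}" "j \<in> {j \<in> {1..n}. dl (Suc i) ! b = up (dl i ! a) j}"
    then show "valid_path n m (yv (dl i ! a), [j])"
      using up_valid[of j "dl i ! a"] dl_box[of b "Suc i"] by (auto simp: valid_path_def)
    show "inkQ n m (u b)" using assms(1) * by (auto simp: in_free_def)
  qed auto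
  show "src_is (L i ! a) (dmap (Suc i) u a)"
    unfolding src_is_def
  proof (intro allI impI)
    fix p assume "dmap (Suc i) u a p \<noteq> 0"
    then obtain b where "(\<Sum>j | j \<in> {1..n} \<and> dl (Suc i) ! b = up (dl i ! a) j.
        sg (dl i ! a) j * amult n (delta (yv (dl i ! a), [j])) (u b) p) \<noteq> 0"
      unfolding dmap_eq[OF assms(2)] by (rule sum.not_neutral_contains_not_neutral)
    then obtain j where "sg (dl i ! a) j * amult n (delta (yv (dl i ! a), [j])) (u b) p \<noteq> 0"
      by (rule sum.not_neutral_contains_not_neutral)
    then have "amult n (delta (yv (dl i ! a), [j])) (u b) p \<noteq> 0" by auto
    moreover have "src_is (yv (dl i ! a)) (amult n (delta (yv (dl i ! a), [j])) (u b))"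
      by (rule src_is_amult) (simp add: src_is_def delta_def)
    ultimately show "fst p = L i ! a" using assms(2) by (metis nth_L src_is_def)
  qed
qed

text \<open>After exchanging the sums, for each j only the position of \<open>up d j\<close> in the
  list contributes; if \<open>up d j\<close> is not in the index set, \<open>fam\<close> is 0 there
  anyway.\<close>

lemma coef_dmap:
  assumes a: "a < length (dl i)"
  shows "coef (dmap (Suc i) u a) (yv (dl i ! a)) A = dd (fam (Suc i) u) (dl i ! a) A"
proof -
  define d where "d = dl i ! a"
  define T where "T j = (if j \<in> A then sg d j * fam (Suc i) u (up d j) (A - {j}) else 0)" for j
  have "coef (dmap (Suc i) u a) (yv d) A = (\<Sum>b<length (dl (Suc i)).
    \<Sum>j | j \<in> {1..n} \<and> dl (Suc i) ! b = up d j.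
      sg d j * coef (amult n (delta (yv d, [j])) (u b)) (yv d) A)"
    unfolding dmap_eq[OF a] d_def by (simp add: coef_sum coef_smult)
  also have "\<dots> = (\<Sum>b<length (dl (Suc i)). \<Sum>j | j \<in> {1..n} \<and> dl (Suc i) ! b = up d j. T j)"
  proof (intro sum.cong refl)
    fix b j assume *: "b \<in> {..<length (dl (Suc i))}" "j \<in> {j \<in> {1..n}. dl (Suc i) ! b = up d j}"
    then have j: "j \<in> {1..n}" and b: "b < length (dl (Suc i))" "dl (Suc i) ! b = up d j" by auto
    have "up d j \<in> idx (Suc i)" using dl_idx[OF b(1)] b(2) by simp
    moreover have "pos (Suc i) (up d j) = b" using pos_nth[OF b(1)] b(2) by simp
    moreover have "valid_walk n m (yv d) [j]" using up_valid[OF j] dl_box[OF b(1)] b(2) by simp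
    ultimately show "sg d j * coef (amult n (delta (yv d, [j])) (u b)) (yv d) A = T j"
      using coef_arrow[OF j, of "yv d" "u b" A] by (simp add: T_def fam_def yv_up[OF j])
  qed
  also have "\<dots> = (\<Sum>b<length (dl (Suc i)). \<Sum>j\<in>{1..n}. if dl (Suc i) ! b = up d j then T j else 0)"
    by (intro sum.cong refl sum.inter_filter) auto
  also have "\<dots> = (\<Sum>j\<in>{1..n}. \<Sum>b<length (dl (Suc i)). if dl (Suc i) ! b = up d j then T j else 0)"
    by (rule sum.swap)
  also have "\<dots> = (\<Sum>j\<in>{1..n}. T j)"
    by (intro sum.cong refl) (auto simp: sum_dl_delta T_def fam_def)
  also have "\<dots> = dd (fam (Suc i) u) d A"
    unfolding dd_def T_def by (rule sum.inter_restrict[symmetric]) simp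
  finally show ?thesis unfolding d_def .
qed

lemma fam_dmap: "fam i (dmap (Suc i) u) = dd (fam (Suc i) u)"
proof (intro ext)
  fix d A
  show "fam i (dmap (Suc i) u) d A = dd (fam (Suc i) u) d A"
  proof (cases "d \<in> idx i")
    case True
    then show ?thesis using coef_dmap[OF pos(1)[OF True], of u A] pos(2)[OF True] by (simp add: fam_def)
  next
    case False
    have "fam (Suc i) u (up d j) (A - {j}) = 0" if "j \<in> {1..n} \<inter> A" for j
      using up_idx[of j d i] that False by (auto simp: fam_def)
    then have "dd (fam (Suc i) u) d A = 0" unfolding dd_def by (intro sum.neutral) auto
    then show ?thesis using False by (simp add: fam_def)
  qed
qed

lemma fam_zero_iff:
  assumes "\<And>b. b < length (dl i) \<Longrightarrow> inkQ n m (v b) \<and> src_is (L i ! b) (v b)"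
  shows "(\<forall>b<length (dl i). v b \<in> Gam) \<longleftrightarrow> (\<forall>d A. fam i v d A = 0)"
proof
  assume *: "\<forall>b<length (dl i). v b \<in> Gam"
  have "coef (v (pos i d)) y A = 0" if "d \<in> idx i" for d y A
    using *[rule_format, OF pos(1)[OF that]] Gam_iff by blast
  then show "\<forall>d A. fam i v d A = 0" by (simp add: fam_def)
next
  assume *: "\<forall>d A. fam i v d A = 0"
  show "\<forall>b<length (dl i). v b \<in> Gam"
  proof (intro allI impI)
    fix b assume b: "b < length (dl i)"
    have "coef (v b) (yv (dl i ! b)) A = 0" for A
      using *[rule_format, of "dl i ! b" A] dl_idx[OF b] pos_nth[OF b] by (simp add: fam_def)
    then show "v b \<in> Gam" using Gam_iff_source assms[OF b] nth_L[OF b] by metis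
  qed
qed

lemma fam_diff: "fam i (\<lambda>b p. v b p - w b p) d A = fam i v d A - fam i w d A"
  by (simp add: fam_def coef_diff)

lemma admissible_fam: "admissible (fam i v)"
  unfolding admissible_def
proof (intro allI impI)
  fix d A assume "fam i v d A \<noteq> 0"
  then have d: "d \<in> idx i" and "coef (v (pos i d)) (yv d) A \<noteq> 0"
    by (auto simp: fam_def split: if_splits)
  then obtain w where "sorted_wrt lt w" "w \<in> words (yv d) A" using sorted_word_exists by blast
  moreover from this have "A \<subseteq> {..n}" using valid_walk_labels by (auto simp: words_def)
  ultimately show "d \<in> box \<and> A \<subseteq> {..n} \<and> (\<exists>w\<in>words (yv d) A. sorted_wrt lt w)"
    using d by (auto simp: idx_def)
qed

lemma in_free_lift: "in_free n m (L i) (lift i V)"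
proof -
  have "inkQ n m (lift i V b)" for b
  proof -
    let ?W = "{w. set w \<subseteq> {..n} \<and> distinct w}"
    have "lift i V b p \<noteq> 0 \<Longrightarrow> p \<in> {yv (dl i ! b)} \<times> ?W \<and> valid_path n m p" for p
      using valid_walk_labels[of "fst p" "snd p"] lt_sorted_distinct[of "mn (dl i ! b) # snd p"]
      by (cases p) (auto simp: lift_def Let_def valid_path_def split: if_splits)
    moreover have "finite ({yv (dl i ! b)} \<times> ?W)"
      using finite_subset_distinct[of "{..n}"] by simp
    ultimately show ?thesis unfolding inkQ_def by (blast intro: finite_subset)
  qed
  moreover have "src_is (yv (dl i ! b)) (lift i V b)" for b
    by (auto simp: src_is_def lift_def Let_def split: if_splits)
  moreover have "lift i V b = (\<lambda>_. 0)" if "length (dl i) \<le> b" for b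
    using that by (auto simp: lift_def Let_def)
  ultimately show ?thesis by (simp add: in_free_def nth_L)
qed

text \<open>Admissibility makes \<open>htp V\<close> realizable: a sorted word of B + {j} at
  \<open>yv d0\<close> begins with j, and its tail is a path at \<open>yv d\<close> with label set
  B. So nonzero values of \<open>htp V\<close> sit on basis paths.\<close>

lemma fam_lift:
  assumes V: "admissible V" and supp: "\<And>d A. V d A \<noteq> 0 \<Longrightarrow> d \<in> idx i"
  shows "fam (Suc i) (lift (Suc i) V) = htp V"
proof (intro ext)
  fix d B
  define j where "j = mn d"
  define d0 where "d0 = d(j := d j - 1)"
  have htp: "htp V d B = (if d \<in> box \<and> d \<noteq> (\<lambda>_. 0) \<and> B \<inter> {1..j} = {} then V d0 (insert j B) else 0)"
    by (simp add: htp_def j_def d0_def)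
  have d0: "j \<in> {1..n}" "up d0 j = d" if "d \<in> box" "d \<noteq> (\<lambda>_. 0)"
    using mn_range[OF that] mn_nonzero[OF that(2)] by (auto simp: j_def d0_def up_def)
  show "fam (Suc i) (lift (Suc i) V) d B = htp V d B"
  proof (cases "d \<in> idx (Suc i)")
    case False
    have "htp V d B = 0"
    proof (rule ccontr)
      assume "htp V d B \<noteq> 0"
      then have *: "d \<in> box" "d \<noteq> (\<lambda>_. 0)" "V d0 (insert j B) \<noteq> 0"
        unfolding htp by (auto split: if_splits)
      then have "deg d = Suc i" using supp[OF *(3)] deg_up[of j d0] d0 by (simp add: idx_def)
      then show False using False * by (simp add: idx_def)
    qed
    then show ?thesis using False by (simp add: fam_def)
  next
    case True
    define a where "a = lift (Suc i) V (pos (Suc i) d)"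
    have db: "d \<in> box" "d \<noteq> (\<lambda>_. 0)" using True by (auto simp: idx_def deg_def)
    have a: "a (yv d, w) = (if sorted_wrt lt (j # w) \<and> valid_walk n m (yv d) w
      then V d0 (insert j (set w)) else 0)" for w
      using pos[OF True] by (simp add: a_def lift_def Let_def j_def d0_def)
    have lhs: "fam (Suc i) (lift (Suc i) V) d B = coef a (yv d) B"
      using True by (simp add: fam_def a_def)
    show ?thesis
    proof (cases "\<exists>w\<in>words (yv d) B. sorted_wrt lt (j # w)")
      case True
      then obtain w where w: "w \<in> words (yv d) B" "sorted_wrt lt (j # w)" by blast
      have "coef a (yv d) B = a (yv d, w)"
        using w by (intro coef_sorted_support) (auto simp: a split: if_splits)
      also have "\<dots> = V d0 (insert j B)" using w by (simp add: a words_def)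
      moreover have "B \<inter> {1..j} = {}" using w by (auto simp: words_def lt_def)
      ultimately show ?thesis using lhs htp db by simp
    next
      case False
      have "a (yv d, w) = 0" if "w \<in> words (yv d) B" for w
        using False that by (auto simp: a)
      then have "coef a (yv d) B = 0" by (simp add: coef_def)
      moreover have "htp V d B = 0"
      proof (rule ccontr)
        assume "htp V d B \<noteq> 0"
        then have *: "B \<inter> {1..j} = {}" "V d0 (insert j B) \<noteq> 0"
          unfolding htp by (auto split: if_splits)
        then obtain w where w: "w \<in> words (yv d0) (insert j B)" "sorted_wrt lt w"
          using V unfolding admissible_def by blast
        then obtain v where v: "w = j # v" "set v = B" "sorted_wrt lt v"
          using lt_sorted_head[of w j B] *(1) d0(1)[OF db] by (auto simp: words_def)
        have "valid_walk n m (yv d) v"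
          using w(1) v(1) yv_up[OF d0(1)[OF db], of d0] d0(2)[OF db] by (simp add: words_def)
        then have "v \<in> words (yv d) B" using v lt_sorted_distinct by (simp add: words_def)
        then show False using False w(2) v(1) by blast
      qed
      ultimately show ?thesis using lhs by simp
    qed
  qed
qed

text \<open>The preimage is the lifted homotopy. In degree 0 every v is a cycle and
  \<open>v0\<close> carries the content; in higher degrees it is the reverse.\<close>

lemma exact:
  assumes v: "in_free n m (L i) v" and cycle: "\<And>d A. dd (fam i v) d A = 0"
    and v0: "\<And>A. A \<inter> {1..n} = {} \<Longrightarrow> fam i v (\<lambda>_. 0) A = 0"
  shows "\<exists>u. in_free n m (L (Suc i)) u \<and> (\<forall>b<length (L i). (\<lambda>p. v b p - dmap (Suc i) u b p) \<in> Gam)"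
proof -
  define u where "u = lift (Suc i) (fam i v)"
  have u: "in_free n m (L (Suc i)) u" unfolding u_def by (rule in_free_lift)
  have "fam i (dmap (Suc i) u) d A = fam i v d A" for d A
  proof -
    have "fam (Suc i) u = htp (fam i v)" unfolding u_def
      by (rule fam_lift[OF admissible_fam]) (auto simp: fam_def split: if_splits)
    then have "fam i (dmap (Suc i) u) d A = dd (htp (fam i v)) d A" by (simp add: fam_dmap)
    also have "\<dots> = fam i v d A" using dd_htp[OF admissible_fam cycle v0] .
    finally show ?thesis .
  qed
  then have "fam i (\<lambda>b p. v b p - dmap (Suc i) u b p) d A = 0" for d A by (simp add: fam_diff)
  moreover have "inkQ n m (\<lambda>p. v b p - dmap (Suc i) u b p) \<and> src_is (L i ! b) (\<lambda>p. v b p - dmap (Suc i) u b p)"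
    if "b < length (dl i)" for b
  proof -
    have "inkQ n m (v b)" "src_is (L i ! b) (v b)" using v that by (auto simp: in_free_def)
    then show ?thesis using dmap_inkQ_src[OF u that] inkQ_diff unfolding src_is_def
      by (metis diff_0_right)
  qed
  ultimately have "\<forall>b<length (dl i). (\<lambda>p. v b p - dmap (Suc i) u b p) \<in> Gam"
    using fam_zero_iff[of i "\<lambda>b p. v b p - dmap (Suc i) u b p"] by simp
  then show ?thesis using u by auto
qed

section \<open>Degree zero: the kernel of P_x -> Delta_x\<close>

lemma dl_0: "dl 0 = [\<lambda>_. 0]"
proof -
  have "0 \<le> x ! k" if "k \<le> n" for k using that vert_x vert_iff by blast
  then have "(\<lambda>_. 0) \<in> idx 0" by (auto simp: idx_def box_def deg_def)
  moreover have "d = (\<lambda>_. 0)" if "d \<in> idx 0" for d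
  proof
    fix k show "d k = 0" using that by (cases "k \<in> {1..n}") (auto simp: idx_def box_def deg_def)
  qed
  ultimately have "set (dl 0) = {\<lambda>_. 0}" using dl(2) by blast
  moreover from this have "length (dl 0) = 1" using distinct_card[OF dl(1), of 0] by simp
  ultimately show ?thesis by (cases "dl 0") auto
qed

text \<open>Labels other than 0 never lower the last coordinate, whereas alpha_0 does. This is why
  the label set {0} survives in the standard module.\<close>

lemma step_0_not_above: "\<not> vle n m x (step x 0)"
proof
  assume "vle n m x (step x 0)"
  then obtain w where w: "valid_walk n m x w" "0 \<notin> set w" "walk n x w = step x 0"
    unfolding vle_def by blast
  have len: "length x = Suc n" using vert_length[OF vert_x] .
  have "0 \<le> (\<Sum>i\<leftarrow>w. (if n = i then 1 else 0) - (if n = prd i then 1 else (0::int)))"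
    using w(2) valid_walk_labels[OF w(1)] by (intro sum_list_nonneg) (force simp: prd_def)
  then have "x ! n \<le> step x 0 ! n" using nth_walk[OF len, of n w] w(3) by simp
  then show False using n_pos by (simp add: nth_step len prd_def)
qed

lemma vle_arrow:
  assumes "j \<in> {1..n}" "valid_walk n m x [j]"
  shows "vle n m x (step x j)" "step x j \<noteq> x"
proof -
  show "vle n m x (step x j)"
    unfolding vle_def using assms by (intro exI[of _ "[j]"]) auto
  have "step x j ! j \<noteq> x ! j"
    using assms(1) vert_length[OF vert_x] prd_neq[of j] by (simp add: nth_step)
  then show "step x j \<noteq> x" by auto
qed

text \<open>\<open>std_kernel\<close> is an intersection, so it is enough that the submodule of
  elements with vanishing coordinates at {} and {0} is among those intersected.\<close>

lemma std_kernel_coef: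
  assumes "a \<in> std_kernel n m Gam x" "A \<subseteq> {0}"
  shows "coef a x A = 0"
proof -
  define U :: "'a alg set" where "U = {a. inkQ n m a \<and> src_is x a \<and> (\<forall>A\<subseteq>{0}. coef a x A = 0)}"
  have "right_submod n m U"
    unfolding right_submod_def
  proof (intro conjI ballI allI impI)
    fix a q assume a: "a \<in> U" "valid_path n m q"
    have "coef (amult n a (delta q)) x A = 0" if "A \<subseteq> {0}" for A
      using a that by (intro coef_amult_right_zero) (auto simp: U_def)
    then show "amult n a (delta q) \<in> U"
      using a(1) by (simp add: U_def inkQ_amult_delta_right[OF a(2)] src_is_amult)
  next
    fix a b assume "a \<in> U" "b \<in> U"
    then show "(\<lambda>p. a p + b p) \<in> U" unfolding U_def src_is_def
      by (auto simp: coef_add inkQ_add) (metis add_0)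
  next
    fix a c assume "a \<in> U"
    then show "(\<lambda>p. c * a p) \<in> U" by (auto simp: U_def src_is_def coef_smult inkQ_smult)
  qed (auto simp: U_def src_is_def inkQ_zero)
  moreover have "\<forall>a\<in>Gam. src_is x a \<longrightarrow> a \<in> U" using Gam_iff by (auto simp: U_def)
  moreover have "a \<in> U" if a: "vle n m x y \<and> y \<noteq> x \<and> inkQ n m a \<and> src_is x a \<and> tgt_is n y a" for y a
  proof -
    \<comment> \<open>Such a word is empty or [0], so it ends at x or at x + f_0, neither of which
      lies strictly above x.\<close>
    have "a (x, w) = 0" if "w \<in> words x A" "A \<subseteq> {0}" for w A
    proof (rule ccontr)
      assume "a (x, w) \<noteq> 0"
      then have y: "walk n x w = y" using a unfolding tgt_is_def ptgt_def by force
      have "w = [] \<or> w = [0]" using that unfolding words_def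
        by (cases w; cases "tl w") auto
      then show False using y a step_0_not_above by auto
    qed
    then have "coef a x A = 0" if "A \<subseteq> {0}" for A using that by (simp add: coef_def)
    then show ?thesis using a by (simp add: U_def)
  qed
  moreover have "\<forall>a\<in>U. inkQ n m a \<and> src_is x a" by (simp add: U_def)
  ultimately have "std_kernel n m Gam x \<subseteq> U" unfolding std_kernel_def by blast
  then show ?thesis using assms by (auto simp: U_def)
qed

text \<open>Each arrow from x with label j > 0 ends above x and so lies in every submodule of the
  intersection; the first differential produces combinations of multiples of these arrows.\<close>

lemma dmap_std_kernel:
  assumes u: "in_free n m (L 1) u"
  shows "dmap 1 u 0 \<in> std_kernel n m Gam x"
  unfolding std_kernel_def
proof (rule InterI, unfold mem_Collect_eq, elim conjE)
  fix U :: "'a alg set"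
  assume U: "right_submod n m U"
    and above: "\<forall>y a. vle n m x y \<and> y \<noteq> x \<and> inkQ n m a \<and> src_is x a \<and> tgt_is n y a \<longrightarrow> a \<in> U"
  have "(\<lambda>p. sg (\<lambda>_. 0) j * amult n (delta (x, [j])) (u b) p) \<in> U"
    if b: "b < length (dl 1)" and j: "j \<in> {1..n}" "dl 1 ! b = up (\<lambda>_. 0) j" for b j
  proof -
    have v: "valid_walk n m x [j]" using up_valid[OF j(1), of "\<lambda>_. 0"] dl_box[OF b] j(2) yv_zero by simp
    have "inkQ n m (delta (x, [j]) :: 'a alg)" using v by (simp add: inkQ_delta valid_path_def)
    moreover have "src_is x (delta (x, [j]) :: 'a alg)" "tgt_is n (step x j) (delta (x, [j]) :: 'a alg)"
      by (auto simp: src_is_def tgt_is_def ptgt_def delta_def)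
    ultimately have "delta (x, [j]) \<in> U" using above vle_arrow[OF j(1) v] by blast
    moreover have "inkQ n m (u b)" using u b by (simp add: in_free_def)
    ultimately have "amult n (delta (x, [j])) (u b) \<in> U" using right_submod_amult[OF U] by blast
    then show ?thesis using U unfolding right_submod_def by blast
  qed
  then have "(\<lambda>p. \<Sum>b<length (dl 1). \<Sum>j | j \<in> {1..n} \<and> dl 1 ! b = up (\<lambda>_. 0) j.
      sg (\<lambda>_. 0) j * amult n (delta (x, [j])) (u b) p) \<in> U"
    by (intro right_submod_sum[OF U]) auto
  then show "dmap 1 u 0 \<in> U" using dmap_eq[of 0 0 u] by (simp add: dl_0 yv_zero)
qed

lemma std_kernel_zero: "(\<lambda>p. 0) \<in> std_kernel n m I x"
  by (auto simp: std_kernel_def right_submod_def)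

theorem linear_resolution: "has_linear_resolution n m (Gam :: 'k::field alg set) x"
proof -
  \<comment> \<open>Degree 0 is the single projective P_x, and the trivial path makes the
    augmentation the identity on it.\<close>
  define eps :: "nat \<Rightarrow> 'k alg" where "eps = (\<lambda>b. delta (x, []))"
  have len0: "length (L 0) = 1" and L0: "L 0 ! 0 = x" by (simp_all add: dl_0 nth_L yv_zero)
  have aug: "(\<lambda>p. \<Sum>b<length (L 0). amult n (eps b) (v b) p) = v 0" if "src_is x (v 0)" for v
    using amult_id[OF that] by (simp add: eps_def dl_0)
  have vert: "\<forall>i. \<forall>a<length (L i). vert n m (L i ! a)"
    using vert_yv dl_box by (simp add: nth_L)
  have eps: "\<forall>b<length (L 0). inkQ n m (eps b) \<and> src_is x (eps b) \<and> tgt_is n (L 0 ! b) (eps b)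
    \<and> homog 0 (eps b)"
    using len0 L0 vert_x
    by (auto simp: eps_def inkQ_delta valid_path_def)
       (auto simp: src_is_def tgt_is_def ptgt_def homog_def delta_def)
  have surj: "\<exists>v. in_free n m (L 0) v \<and>
      (\<lambda>p. (\<Sum>b<length (L 0). amult n (eps b) (v b) p) - w p) \<in> std_kernel n m Gam x"
    if w: "inkQ n m w \<and> src_is x w" for w
  proof -
    define v where "v = (\<lambda>b::nat. if b = 0 then w else (\<lambda>_. 0))"
    have "(\<lambda>p. \<Sum>b<length (L 0). amult n (eps b) (v b) p) = w" using aug[of v] w by (simp add: v_def)
    then have "(\<lambda>p. (\<Sum>b<length (L 0). amult n (eps b) (v b) p) - w p) = (\<lambda>p. 0)"
      by (metis (mono_tags) diff_self)
    then have "(\<lambda>p. (\<Sum>b<length (L 0). amult n (eps b) (v b) p) - w p) \<in> std_kernel n m Gam x"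
      by (simp only: std_kernel_zero)
    moreover have "in_free n m (L 0) v" using w len0 L0 by (auto simp: in_free_def v_def)
    ultimately show ?thesis by blast
  qed
  have aug_d: "(\<lambda>p. \<Sum>b<length (L 0). amult n (eps b) (dmap 1 u b) p) \<in> std_kernel n m Gam x"
    if u: "in_free n m (L 1) u" for u
  proof -
    have "src_is x (dmap 1 u 0)" using dmap_inkQ_src(2)[of 0 u 0] u L0 by (simp add: dl_0)
    then show ?thesis using aug dmap_std_kernel[OF u] by simp
  qed
  have exact0: "\<exists>u. in_free n m (L 1) u \<and> (\<forall>b<length (L 0). (\<lambda>p. v b p - dmap 1 u b p) \<in> Gam)"
    if v: "in_free n m (L 0) v"
      "(\<lambda>p. \<Sum>b<length (L 0). amult n (eps b) (v b) p) \<in> std_kernel n m Gam x" for v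
  proof -
    have src: "src_is x (v 0)" using v(1) len0 L0 by (auto simp: in_free_def)
    have pos0: "pos 0 (\<lambda>_. 0) = 0" using pos_nth[of 0 0] by (simp add: dl_0)
    have idx0: "d \<in> idx 0 \<longleftrightarrow> d = (\<lambda>_. 0)" for d using dl(2)[of 0] by (auto simp: dl_0)
    have "fam 0 v (\<lambda>_. 0) A = 0" if "A \<inter> {1..n} = {}" for A
    proof (cases "A \<subseteq> {0}")
      case True
      then show ?thesis using std_kernel_coef[OF v(2)] aug[of v] src by (simp add: fam_def pos0 yv_zero)
    next
      case False
      \<comment> \<open>A set that avoids 1, ..., n and is not inside {0} has a label beyond n,
        which no path carries.\<close>
      then have "\<not> A \<subseteq> {..n}" using that by fastforce
      then show ?thesis using admissible_fam unfolding admissible_def by metis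
    qed
    \<comment> \<open>Only the zero exponent has degree 0, and no \<open>up d j\<close> is
      zero.\<close>
    moreover have "dd (fam 0 v) d A = 0" for d A
      unfolding dd_def using up_not_zero by (intro sum.neutral) (auto simp: fam_def idx0)
    ultimately show ?thesis using exact[OF v(1)] by simp
  qed
  have complex: "\<forall>a<length (L i). dmap (Suc i) (dmap (Suc (Suc i)) u) a \<in> Gam"
    if u: "in_free n m (L (Suc (Suc i))) u" for i and u :: "nat \<Rightarrow> 'k alg"
  proof -
    \<comment> \<open>The padding by zero beyond the last summand, which \<open>in_free\<close>
      demands, becomes explicit in \<open>w\<close>.\<close>
    define w where "w = (\<lambda>b. if b < length (dl (Suc i)) then dmap (Suc (Suc i)) u b else (\<lambda>_. 0))"
    have w: "dmap (Suc (Suc i)) u = w"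
      unfolding w_def by (auto simp: fun_eq_iff dmap_def matapp_def)
    have "in_free n m (L (Suc i)) w"
      using dmap_inkQ_src[OF u] by (simp add: in_free_def w_def)
    then have "inkQ n m (dmap (Suc i) w a) \<and> src_is (L i ! a) (dmap (Suc i) w a)"
      if "a < length (dl i)" for a using dmap_inkQ_src that by blast
    moreover have "fam i (dmap (Suc i) w) d A = 0" for d A
      unfolding w[symmetric] fam_dmap by (rule dd_dd)
    ultimately show ?thesis using fam_zero_iff[of i "dmap (Suc i) w"] w by simp
  qed
  have exact_Suc: "\<exists>u. in_free n m (L (Suc (Suc i))) u \<and>
      (\<forall>b<length (L (Suc i)). (\<lambda>p. v b p - dmap (Suc (Suc i)) u b p) \<in> Gam)"
    if v: "in_free n m (L (Suc i)) v" "\<forall>a<length (L i). dmap (Suc i) v a \<in> Gam"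
    for i and v :: "nat \<Rightarrow> 'k alg"
  proof (rule exact[OF v(1)])
    show "dd (fam (Suc i) v) d A = 0" for d A
      using fam_zero_iff[of i "dmap (Suc i) v"] dmap_inkQ_src[OF v(1)] v(2) by (simp add: fam_dmap)
    \<comment> \<open>The zero exponent has degree 0, so it indexes no summand here.\<close>
    show "fam (Suc i) v (\<lambda>_. 0) A = 0" for A by (simp add: fam_def idx_def deg_def)
  qed
  show ?thesis
    unfolding has_linear_resolution_def Let_def
    apply (rule exI[of _ L], rule exI[of _ Dif], rule exI[of _ eps])
    unfolding dmap_def[symmetric]
    using vert lin_map_Dif eps surj aug_d exact0 complex exact_Suc by blast
qed

end

theorem mainTheorem8:
  fixes n s :: nat and x :: "int list"
  assumes "1 \<le> n" and "1 \<le> s"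
    and alg_closed: "\<forall>p :: 'k::field poly. 0 < degree p \<longrightarrow> (\<exists>z. poly p z = 0)"
    and "vert n (Suc s) x"
  shows "has_linear_resolution n (Suc s) (Gamma_ideal n s :: 'k alg set) x"
proof -
  interpret resolution n s x using assms by unfold_locales
  show ?thesis by (rule linear_resolution)
qed

end
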